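(* There exists an absolute constant $c>0$ such that for every $n\ge 2$ and every convex body $K$ in $\mathbb{R}^n$ with centroid at the origin, one has $$c\,I(K)\subset CI(K)\subset I(K).$$
   Context: A convex body is a compact convex set with nonempty interior; its centroid is $\frac{1}{|K|}\int_K x\,dx$. $|\cdot|$ denotes volume in the appropriate dimension (here $(n-1)$-dimensional volume in hyperplanes). For $u\in S^{n-1}$, $u^\perp=\{x\in\mathbb{R}^n:\langle u,x\rangle=0\}$ and $P_u$ is the orthogonal projection onto $u^\perp$. A star body $L$ in $\mathbb{R}^n$ is a compact set such that $[0,x]\subset L$ for every $x\in L$ and whose radial function $r_L(u)=\max\{t\ge0: tu\in L\}$, $u\in S^{n-1}$, is positive and continuous. The intersection body $I(K)$ of $K$ is the star body with radial function $r_{I(K)}(u)=|K\cap u^\perp|_{n-1}$, $u\in S^{n-1}$. Let $K^*=\{y\in\mathbb{R}^n:\langle x,y\rangle\le 1\ \text{for all } x\in K\}$ be the polar body of $K$ with respect to $0$. For $C\subset u^\perp$ and $z\in u^\perp$, let $C^{*z}=\{y\in u^\perp:\langle y-z,x-z\rangle\le 1\ \text{for all } x\in C\}$. When $K$ has centroid at the origin, the convex intersection body $CI(K)$ of $K$ is the body with radial function $$r_{CI(K)}(u)=\min_{z\in u^\perp}\big|(P_uK^* )^{*z}\big|_{n-1},\quad u\in S^{n-1}.$$ *)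

theory Defs
  imports "HOL-Analysis.Analysis"
begin

text \<open>
  The dimension \<open>n\<close> must range over the naturals inside a formula (the constant of the theorem does not
  depend on it), so \<open>\<real>\<^sup>n\<close> is the carrier of the library topology \<^const>\<open>Euclidean_space\<close> \<open>n\<close>: the functions
  \<open>nat \<Rightarrow> real\<close> that vanish at all indices \<open>i \<ge> n\<close>.
\<close>

type_synonym vec = "nat \<Rightarrow> real"

abbreviation Rn :: "nat \<Rightarrow> vec set" where
  "Rn n \<equiv> topspace (Euclidean_space n)"

definition dot :: "nat \<Rightarrow> vec \<Rightarrow> vec \<Rightarrow> real" where
  "dot n x y = (\<Sum>i<n. x i * y i)"

definition smul :: "real \<Rightarrow> vec \<Rightarrow> vec" where
  "smul t x = (\<lambda>i. t * x i)"

definition vdiff :: "vec \<Rightarrow> vec \<Rightarrow> vec" where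
  "vdiff x y = (\<lambda>i. x i - y i)"

definition unit_sphere :: "nat \<Rightarrow> vec set" where
  "unit_sphere n = {u \<in> Rn n. sqrt (dot n u u) = 1}"

definition hyperplane :: "nat \<Rightarrow> vec \<Rightarrow> vec set" where
  "hyperplane n u = {x \<in> Rn n. dot n u x = 0}"

text \<open>
  Lebesgue measure of \<open>\<real>\<^sup>n\<close>, as a Borel measure on \<open>nat \<Rightarrow> real\<close> concentrated on \<^term>\<open>Rn n\<close>. The product
  measure lives on functions that are \<^const>\<open>undefined\<close> at the indices \<open>i \<ge> n\<close>, which are reset to \<open>0\<close>.
\<close>

definition leb :: "nat \<Rightarrow> vec measure" where
  "leb n = distr (Pi\<^sub>M {..<n} (\<lambda>_. lborel)) borel (\<lambda>x i. if i < n then x i else 0)"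

text \<open>
  The \<open>(n-1)\<close>-dimensional volume on \<open>u\<^sup>\<bottom>\<close> (\<open>u\<close> a unit vector) is Lebesgue measure of \<open>\<real>\<^bsup>n-1\<^esup>\<close> transported by a
  linear isometry onto \<open>u\<^sup>\<bottom>\<close>. The isometry is given by an orthonormal basis of \<open>u\<^sup>\<bottom>\<close>; by rotation
  invariance of Lebesgue measure the result does not depend on the basis chosen.
\<close>

definition orthonormal_basis_of_hyperplane :: "nat \<Rightarrow> vec \<Rightarrow> (nat \<Rightarrow> vec) \<Rightarrow> bool" where
  "orthonormal_basis_of_hyperplane n u e \<longleftrightarrow>
     (\<forall>j<n-1. e j \<in> hyperplane n u) \<and>
     (\<forall>j<n-1. \<forall>k<n-1. dot n (e j) (e k) = (if j = k then 1 else 0))"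

definition hyperplane_leb :: "nat \<Rightarrow> vec \<Rightarrow> vec measure" where
  "hyperplane_leb n u =
     (let e = (SOME e. orthonormal_basis_of_hyperplane n u e)
      in distr (leb (n-1)) borel (\<lambda>a i. \<Sum>j<n-1. a j * e j i))"

definition convex_set :: "vec set \<Rightarrow> bool" where
  "convex_set K \<longleftrightarrow>
     (\<forall>x\<in>K. \<forall>y\<in>K. \<forall>t\<in>{0..1}. (\<lambda>i. (1 - t) * x i + t * y i) \<in> K)"

definition convex_body :: "nat \<Rightarrow> vec set \<Rightarrow> bool" where
  "convex_body n K \<longleftrightarrow>
     compactin (Euclidean_space n) K \<and> convex_set K \<and> Euclidean_space n interior_of K \<noteq> {}"

definition centroid :: "nat \<Rightarrow> vec set \<Rightarrow> vec" where
  "centroid n K = (\<lambda>i. (1 / measure (leb n) K) * (LINT x:K|leb n. x i))"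

definition polar :: "nat \<Rightarrow> vec set \<Rightarrow> vec set" where
  "polar n K = {y \<in> Rn n. \<forall>x\<in>K. dot n x y \<le> 1}"

definition hyperplane_polar :: "nat \<Rightarrow> vec \<Rightarrow> vec \<Rightarrow> vec set \<Rightarrow> vec set" where
  "hyperplane_polar n u z C =
     {y \<in> hyperplane n u. \<forall>x\<in>C. dot n (vdiff y z) (vdiff x z) \<le> 1}"

definition proj :: "nat \<Rightarrow> vec \<Rightarrow> vec \<Rightarrow> vec" where
  "proj n u x = vdiff x (smul (dot n u x) u)"

definition radial_fun :: "vec set \<Rightarrow> vec \<Rightarrow> real" where
  "radial_fun L u = (GREATEST t. 0 \<le> t \<and> smul t u \<in> L)"

definition star_body :: "nat \<Rightarrow> vec set \<Rightarrow> bool" where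
  "star_body n L \<longleftrightarrow>
     compactin (Euclidean_space n) L \<and> L \<noteq> {} \<and>
     (\<forall>x\<in>L. \<forall>t\<in>{0..1}. smul t x \<in> L) \<and>
     (\<forall>u\<in>unit_sphere n. radial_fun L u > 0) \<and>
     continuous_map (subtopology (Euclidean_space n) (unit_sphere n)) euclideanreal (radial_fun L)"

text \<open>
  The body with a prescribed radial function \<open>r\<close>. The lemmas \<open>radial_fun_radial_body\<close> and
  \<open>star_body_eq_radial_body\<close> below show that it has radial function \<open>r\<close> and that it is the only
  star body that can have it.
\<close>

definition radial_body :: "nat \<Rightarrow> (vec \<Rightarrow> real) \<Rightarrow> vec set" where
  "radial_body n r = {smul t u | t u. u \<in> unit_sphere n \<and> 0 \<le> t \<and> t \<le> r u}"

definition intersection_body :: "nat \<Rightarrow> vec set \<Rightarrow> vec set" where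
  "intersection_body n K =
     radial_body n (\<lambda>u. measure (hyperplane_leb n u) (K \<inter> hyperplane n u))"

text \<open>
  The volumes in the minimum are taken in \<^typ>\<open>ennreal\<close>: when \<open>z\<close> is not interior to \<open>P\<^sub>u K\<^sup>*\<close> relative to
  \<open>u\<^sup>\<bottom>\<close>, the polar about \<open>z\<close> has infinite volume, to which \<^const>\<open>measure\<close> would assign \<open>0\<close>.
  The infimum is finite for a convex body \<open>K\<close> with centroid \<open>0\<close> and it is attained, at the Santalo point.
\<close>

definition convex_intersection_body :: "nat \<Rightarrow> vec set \<Rightarrow> vec set" where
  "convex_intersection_body n K =
     radial_body n (\<lambda>u. enn2real
       (INF z\<in>hyperplane n u.
          emeasure (hyperplane_leb n u) (hyperplane_polar n u z (proj n u ` polar n K))))"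

lemma measurable_leb_embedding:
  fixes n :: nat
  shows "(\<lambda>x i. if i < n then x i else 0) \<in> measurable (Pi\<^sub>M {..<n} (\<lambda>_. lborel :: real measure)) borel"
proof (rule measurable_coordinatewise_then_product)
  fix i :: nat
  show "(\<lambda>x. if i < n then x i else 0) \<in> borel_measurable (Pi\<^sub>M {..<n} (\<lambda>_. lborel :: real measure))"
    by (cases "i < n") (auto intro: measurable_component_singleton)
qed

lemma measurable_hyperplane_embedding:
  fixes e :: "nat \<Rightarrow> vec"
  shows "(\<lambda>a i. \<Sum>j<m. a j * e j i) \<in> measurable (leb k) borel"
proof -
  have "(\<lambda>a i. \<Sum>j<m. a j * e j i) \<in> borel_measurable (borel :: vec measure)"
    by (rule measurable_coordinatewise_then_product) measurable
  then show ?thesis by (simp add: leb_def cong: measurable_cong_sets)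
qed

lemma smul_in_Rn: "x \<in> Rn n \<Longrightarrow> smul t x \<in> Rn n"
  by (simp add: topspace_Euclidean_space smul_def)

lemma smul_smul [simp]: "smul s (smul t x) = smul (s * t) x"
  by (simp add: smul_def mult.assoc)

lemma dot_smul_left: "dot n (smul t x) y = t * dot n x y"
  by (simp add: dot_def smul_def sum_distrib_left mult.assoc)

lemma dot_smul_right: "dot n x (smul t y) = t * dot n x y"
  by (simp add: dot_def smul_def sum_distrib_left mult_ac)

lemma unit_sphere_dot: "u \<in> unit_sphere n \<Longrightarrow> dot n u u = 1"
  by (simp add: unit_sphere_def)

lemma smul_in_radial_body_iff:
  assumes "u \<in> unit_sphere n" "0 \<le> t" "0 \<le> r u"
  shows "smul t u \<in> radial_body n r \<longleftrightarrow> t \<le> r u"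
proof
  assume "smul t u \<in> radial_body n r"
  then obtain s v where sv: "smul t u = smul s v" "v \<in> unit_sphere n" "0 \<le> s" "s \<le> r v"
    by (auto simp: radial_body_def)
  have "t * t = dot n (smul t u) (smul t u)"
    using assms by (simp add: dot_smul_left dot_smul_right unit_sphere_dot)
  also have "\<dots> = s * s"
    using sv by (simp add: dot_smul_left dot_smul_right unit_sphere_dot)
  finally have ts: "t = s"
    using assms(2) sv(3) by (simp add: power2_eq_square[symmetric])
  show "t \<le> r u"
  proof (cases "t = 0")
    case False
    have "smul (1 / t) (smul t u) = smul (1 / t) (smul t v)"
      using sv ts by simp
    then have "u = v"
      using False by (simp add: smul_def)
    then show ?thesis using sv ts by simp
  qed (use assms in simp)
qed (use assms in \<open>auto simp: radial_body_def\<close>)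

lemma radial_fun_radial_body:
  assumes "u \<in> unit_sphere n" "0 \<le> r u"
  shows "radial_fun (radial_body n r) u = r u"
  unfolding radial_fun_def
  by (rule Greatest_equality) (use assms smul_in_radial_body_iff[of u n _ r] in auto)

lemma star_body_eq_radial_body:
  assumes L: "star_body n L" and r: "\<And>u. u \<in> unit_sphere n \<Longrightarrow> radial_fun L u = r u"
    and n: "n > 0"
  shows "L = radial_body n r"
proof -
  have LR: "L \<subseteq> Rn n" and ne: "L \<noteq> {}"
    and star: "\<And>x t. x \<in> L \<Longrightarrow> 0 \<le> t \<Longrightarrow> t \<le> 1 \<Longrightarrow> smul t x \<in> L"
    using L by (auto simp: star_body_def compactin_subspace)
  have "compactin euclidean L"
    using L by (simp add: star_body_def Euclidean_space_def compactin_subtopology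
        euclidean_product_topology)
  then have cL: "compact L" by simp
  have iff: "smul t u \<in> L \<longleftrightarrow> t \<le> r u" if u: "u \<in> unit_sphere n" and t: "0 \<le> t" for u t
  proof -
    define T where "T = {t. 0 \<le> t \<and> smul t u \<in> L}"
    have cont: "continuous_on UNIV (\<lambda>t. smul t u)"
      unfolding smul_def by (intro continuous_on_coordinatewise_then_product continuous_intros)
    have "closed ({0..} \<inter> (\<lambda>t. smul t u) -` L)"
      by (intro closed_Int closed_vimage compact_imp_closed[OF cL] cont closed_atLeast)
    moreover have "{0..} \<inter> (\<lambda>t. smul t u) -` L = T" by (auto simp: T_def)
    ultimately have clT: "closed T" by simp
    have "continuous_on L (\<lambda>x. dot n x u)"
      unfolding dot_def
      by (intro continuous_intros continuous_on_product_then_coordinatewise continuous_on_id)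
    then have "bounded ((\<lambda>x. dot n x u) ` L)"
      using cL by (intro compact_imp_bounded compact_continuous_image)
    moreover have "T \<subseteq> (\<lambda>x. dot n x u) ` L"
    proof
      fix t assume "t \<in> T"
      then have "smul t u \<in> L" by (simp add: T_def)
      moreover have "t = dot n (smul t u) u"
        using u by (simp add: dot_smul_left unit_sphere_dot)
      ultimately show "t \<in> (\<lambda>x. dot n x u) ` L" by blast
    qed
    ultimately have "bounded T" by (rule bounded_subset)
    then have cT: "compact T" using clT by (simp add: compact_eq_bounded_closed)
    obtain x where "x \<in> L" using ne by auto
    then have "smul 0 u \<in> L" using star[of x 0] by (simp add: smul_def)
    then have "T \<noteq> {}" by (auto simp: T_def)
    then obtain m where m: "m \<in> T" "\<And>s. s \<in> T \<Longrightarrow> s \<le> m"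
      using compact_attains_sup[OF cT] by auto
    have "radial_fun L u = m"
      unfolding radial_fun_def by (rule Greatest_equality) (use m in \<open>auto simp: T_def\<close>)
    then have rm: "r u = m" using r[OF u] by simp
    show ?thesis
    proof
      assume "smul t u \<in> L"
      then show "t \<le> r u" using m t rm by (simp add: T_def)
    next
      assume le: "t \<le> r u"
      show "smul t u \<in> L"
      proof (cases "m = 0")
        case True
        then show ?thesis using le t rm m by (simp add: T_def)
      next
        case False
        then have "0 < m" using m by (simp add: T_def)
        then show ?thesis
          using star[of "smul m u" "t / m"] m le t rm by (simp add: T_def)
      qed
    qed
  qed
  have polar_form: "\<exists>t u. x = smul t u \<and> u \<in> unit_sphere n \<and> 0 \<le> t" if x: "x \<in> Rn n" for x
  proof (cases "dot n x x = 0")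
    case True
    then have "\<forall>i<n. x i = 0"
      by (auto simp: dot_def sum_nonneg_eq_0_iff)
    then have "x = smul 0 (\<lambda>i. if i = 0 then 1 else 0)"
      using x by (simp add: smul_def topspace_Euclidean_space fun_eq_iff) (meson not_le)
    moreover have "(\<lambda>i. if i = 0 then 1 else 0) \<in> unit_sphere n"
    proof -
      let ?d = "\<lambda>i::nat. if i = 0 then 1 else (0::real)"
      have "dot n ?d ?d = (\<Sum>i<n. ?d i)"
        unfolding dot_def by (intro sum.cong) auto
      then show ?thesis
        using n by (simp add: unit_sphere_def topspace_Euclidean_space)
    qed
    ultimately show ?thesis by (metis order_refl)
  next
    case False
    have "dot n x x \<ge> 0" by (simp add: dot_def sum_nonneg)
    define s where "s = sqrt (dot n x x)"
    have s: "s > 0" "s * s = dot n x x"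
      using False \<open>dot n x x \<ge> 0\<close> by (auto simp: s_def)
    have "smul (1 / s) x \<in> unit_sphere n"
      using x s(1) by (simp add: unit_sphere_def smul_in_Rn dot_smul_left dot_smul_right
          s(2)[symmetric])
    moreover have "x = smul s (smul (1 / s) x)"
      using s by (simp add: smul_def)
    ultimately show ?thesis using s by (metis less_imp_le)
  qed
  show ?thesis
  proof (intro set_eqI iffI)
    fix x assume "x \<in> L"
    moreover obtain t u where "x = smul t u" "u \<in> unit_sphere n" "0 \<le> t"
      using polar_form LR \<open>x \<in> L\<close> by blast
    ultimately show "x \<in> radial_body n r"
      using iff by (auto simp: radial_body_def)
  next
    fix x assume "x \<in> radial_body n r"
    then show "x \<in> L" using iff by (auto simp: radial_body_def)
  qed
qed

end

theory Submission
  imports Defs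
begin

text \<open>
  Write \<open>L = K \<inter> u\<^sup>\<bottom>\<close>. The upper inclusion is the choice \<open>z = 0\<close> in the minimum: by the bipolar theorem the
  polar of \<open>P\<^sub>u K\<^sup>*\<close> in \<open>u\<^sup>\<bottom>\<close> is \<open>L\<close> (\<open>hyperplane_polar_proj_polar_at_0\<close>). For the lower inclusion one needs
  no formula for \<open>(P\<^sub>u K\<^sup>*)\<^bsup>*z\<^esup>\<close>: if \<open>y \<in> L\<close> and \<open>\<langle>z, y\<rangle> \<ge> 0\<close>, then for \<open>x \<in> P\<^sub>u K\<^sup>*\<close> one has
  \<open>\<langle>y, x - z\<rangle> \<le> 1 - \<langle>z, y\<rangle> \<le> 1\<close>, so \<open>(P\<^sub>u K\<^sup>*)\<^bsup>*z\<^esup>\<close> contains a translate of the half \<open>{y \<in> L. \<langle>z, y\<rangle> \<ge> 0}\<close> of the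
  section. Everything thus reduces to a statement about sections: each half of a hyperplane section
  through the centroid has at least the fraction \<open>1/64\<close> of its volume, in every dimension
  (\<open>section_half_through_centroid\<close>).

  To see this, let \<open>s\<close> be the coordinate along \<open>u\<close>, let \<open>K\<^sub>s\<close> be the slices of \<open>K\<close> and \<open>G s = |K\<^sub>s|\<close>, and let
  \<open>\<Phi> s \<tau> = |{x \<in> K\<^sub>s. \<langle>z, x\<rangle> > \<tau>}|\<close>. By the Brunn-Minkowski inequality in its multiplicative form,
  \<open>\<Phi>\<close> and \<open>G\<close> are log-concave. Put \<open>\<eta> = \<Phi> 0 0\<close>, the volume of the open half section. The planar set \<open>{\<Phi> > \<eta>}\<close> is
  convex and does not contain the origin, so a line through the origin bounds an open half plane that
  does not meet it. The half space \<open>H\<close> of \<open>\<real>\<^sup>n\<close> over this half plane has its boundary through the centroid, and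
  each of its slices \<open>K\<^sub>s \<inter> H\<close> has volume at most \<open>\<eta>\<close>. Log-concavity of \<open>G\<close>, in the form
  \<open>G s \<le> G (s/2)\<^sup>2 / G 0\<close>, now gives
  \<open>|K \<inter> H| \<le> \<integral> min \<eta> (G s) ds \<le> \<integral> sqrt (\<eta> * G s) ds \<le> sqrt (\<eta> / G 0) * \<integral> G (s/2) ds = 2 * sqrt (\<eta> / G 0) * |K|\<close>.
  On the other hand \<open>|K \<inter> H| \<ge> |K| / 4\<close> by a weak form of Gruenbaum's inequality
  (\<open>half_space_through_centroid\<close>). Hence \<open>\<eta> \<ge> G 0 / 64\<close>.

  Since the dimension is a variable, the facts about \<open>leb n\<close> are proved by induction on \<open>n\<close>. Coordinates adapted to \<open>u\<close> are available because Lebesgue measure is invariant under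
  orthogonal maps (\<open>distr_leb_lincomb\<close>).
\<close>

section \<open>Lebesgue measure one coordinate at a time\<close>

lemma sets_leb [measurable_cong, simp]: "sets (leb n) = sets borel"
  by (simp add: leb_def)

lemma space_leb [simp]: "space (leb n) = UNIV"
  by (simp add: leb_def)

lemma nn_integral_leb:
  assumes [measurable]: "f \<in> borel_measurable borel"
  shows "(\<integral>\<^sup>+x. f x \<partial>leb n) =
    (\<integral>\<^sup>+x. f (\<lambda>i. if i < n then x i else 0) \<partial>Pi\<^sub>M {..<n} (\<lambda>_. lborel))"
  unfolding leb_def by (rule nn_integral_distr) (auto intro: measurable_leb_embedding)

lemma nn_integral_leb_0:
  assumes "f \<in> borel_measurable borel"
  shows "(\<integral>\<^sup>+x. f x \<partial>leb 0) = f (\<lambda>_. 0)"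
  using assms by (simp add: nn_integral_leb PiM_empty nn_integral_count_space_finite)

lemma measurable_fun_upd_vec [measurable]:
  "(\<lambda>p::vec \<times> real. (fst p)(m := snd p)) \<in> borel_measurable (borel \<Otimes>\<^sub>M borel)"
proof (rule measurable_coordinatewise_then_product)
  fix i :: nat
  have "(\<lambda>p::vec \<times> real. fst p i) \<in> borel_measurable (borel \<Otimes>\<^sub>M borel)"
    using measurable_fst measurable_product_coordinates by measurable
  then show "(\<lambda>p::vec \<times> real. ((fst p)(m := snd p)) i) \<in> borel_measurable (borel \<Otimes>\<^sub>M borel)"
    by (cases "i = m") auto
qed

lemma measurable_fun_upd_vec_comp [measurable (raw)]:
  assumes [measurable]: "f \<in> borel_measurable M" "g \<in> borel_measurable M"
  shows "(\<lambda>x. (f x :: vec)(m := g x :: real)) \<in> borel_measurable M"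
  using measurable_compose[OF _ measurable_fun_upd_vec, of "\<lambda>x. (f x, g x)" M m] by simp

lemma measurable_vec_nth [measurable (raw)]:
  assumes [measurable]: "f \<in> borel_measurable M"
  shows "(\<lambda>x. (f x :: vec) i) \<in> borel_measurable M"
  using measurable_compose[OF assms measurable_product_coordinates] by simp

text \<open>
  Tonelli's theorem for the last coordinate. The dimension is a variable, so the facts about \<open>leb n\<close>
  that follow are obtained by induction on \<open>n\<close> from this formula.
\<close>

lemma nn_integral_leb_Suc:
  assumes [measurable]: "f \<in> borel_measurable borel"
  shows "(\<integral>\<^sup>+x. f x \<partial>leb (Suc m)) = (\<integral>\<^sup>+t. (\<integral>\<^sup>+x. f (x(m := t)) \<partial>leb m) \<partial>lborel)"
proof -
  interpret product_sigma_finite "\<lambda>_. lborel :: real measure"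
    by standard
  have [measurable]: "(\<lambda>x i. if i < k then x i else 0) \<in>
      measurable (Pi\<^sub>M {..<k} (\<lambda>_. lborel :: real measure)) borel" for k :: nat
    by (rule measurable_leb_embedding)
  have "(\<integral>\<^sup>+x. f x \<partial>leb (Suc m)) = 
      (\<integral>\<^sup>+x. f (\<lambda>i. if i < Suc m then x i else 0) \<partial>Pi\<^sub>M (insert m {..<m}) (\<lambda>_. lborel))"
    by (simp add: nn_integral_leb lessThan_Suc)
  also have "\<dots> = (\<integral>\<^sup>+t. (\<integral>\<^sup>+x. f (\<lambda>i. if i < Suc m then (x(m := t)) i else 0) \<partial>Pi\<^sub>M {..<m} (\<lambda>_. lborel)) \<partial>lborel)"
    by (rule product_nn_integral_insert_rev) (auto simp flip: lessThan_Suc)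
  also have "\<dots> = (\<integral>\<^sup>+t. (\<integral>\<^sup>+x. f ((\<lambda>i. if i < m then x i else 0)(m := t)) \<partial>Pi\<^sub>M {..<m} (\<lambda>_. lborel)) \<partial>lborel)"
    by (intro nn_integral_cong arg_cong[where f = f]) auto
  also have "\<dots> = (\<integral>\<^sup>+t. (\<integral>\<^sup>+x. f (x(m := t)) \<partial>leb m) \<partial>lborel)"
    by (intro nn_integral_cong) (simp add: nn_integral_leb)
  finally show ?thesis .
qed

lemma emeasure_leb_0: "A \<in> sets borel \<Longrightarrow> emeasure (leb 0) A = indicator A (\<lambda>_. 0)"
  using nn_integral_leb_0[of "indicator A"] by simp

lemma emeasure_leb_Suc:
  assumes [measurable]: "A \<in> sets borel"
  shows "emeasure (leb (Suc m)) A = (\<integral>\<^sup>+t. emeasure (leb m) {x. x(m := t) \<in> A} \<partial>lborel)"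
proof -
  have "emeasure (leb (Suc m)) A = (\<integral>\<^sup>+t. (\<integral>\<^sup>+x. indicator A (x(m := t)) \<partial>leb m) \<partial>lborel)"
    using nn_integral_leb_Suc[of "indicator A" m] by simp
  also have "\<dots> = (\<integral>\<^sup>+t. (\<integral>\<^sup>+x. indicator {x. x(m := t) \<in> A} x \<partial>leb m) \<partial>lborel)"
    by (simp add: indicator_def)
  also have "\<dots> = (\<integral>\<^sup>+t. emeasure (leb m) {x. x(m := t) \<in> A} \<partial>lborel)"
    by (intro nn_integral_cong nn_integral_indicator) (simp add: pred_def)
  finally show ?thesis .
qed

text \<open>
  Cubes serve both ways: a bounded set lies in one and has finite measure, a set with an interior
  point contains one and has positive measure.
\<close>

lemma emeasure_leb_cube:
  assumes "0 \<le> r"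
  shows "emeasure (leb n) {x. \<forall>i<n. \<bar>x i - c i\<bar> < r} = ennreal ((2 * r) ^ n)"
proof (induction n)
  case 0
  then show ?case by (simp add: emeasure_leb_0)
next
  case (Suc n)
  have "emeasure (leb (Suc n)) {x. \<forall>i<Suc n. \<bar>x i - c i\<bar> < r}
      = (\<integral>\<^sup>+t. emeasure (leb n) {x. x(n := t) \<in> {x. \<forall>i<Suc n. \<bar>x i - c i\<bar> < r}} \<partial>lborel)"
    by (intro emeasure_leb_Suc) measurable
  also have "\<dots> = (\<integral>\<^sup>+t. ennreal ((2 * r) ^ n) * indicator {c n - r<..<c n + r} t \<partial>lborel)"
  proof (intro nn_integral_cong)
    fix t
    have "{x. x(n := t) \<in> {x. \<forall>i<Suc n. \<bar>x i - c i\<bar> < r}} =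
        (if \<bar>t - c n\<bar> < r then {x. \<forall>i<n. \<bar>x i - c i\<bar> < r} else {})"
      by (auto simp: less_Suc_eq)
    then show "emeasure (leb n) {x. x(n := t) \<in> {x. \<forall>i<Suc n. \<bar>x i - c i\<bar> < r}} =
        ennreal ((2 * r) ^ n) * indicator {c n - r<..<c n + r} t"
      using Suc.IH by (auto simp: indicator_def abs_less_iff)
  qed
  also have "\<dots> = ennreal ((2 * r) ^ n) * ennreal (2 * r)"
    using assms by (simp add: nn_integral_cmult)
  also have "\<dots> = ennreal ((2 * r) ^ Suc n)"
    using assms by (simp add: ennreal_mult mult.commute)
  finally show ?case .
qed

lemma emeasure_leb_bounded:
  assumes "\<And>x i. x \<in> A \<Longrightarrow> i < n \<Longrightarrow> \<bar>x i\<bar> \<le> R"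
  shows "emeasure (leb n) A < \<infinity>"
proof -
  have "emeasure (leb n) A \<le> emeasure (leb n) {x. \<forall>i<n. \<bar>x i - 0\<bar> < max 0 R + 1}"
  proof (rule emeasure_mono)
    show "A \<subseteq> {x. \<forall>i<n. \<bar>x i - 0\<bar> < max 0 R + 1}"
      using assms by fastforce
  qed measurable
  also have "\<dots> < \<infinity>" by (subst emeasure_leb_cube) auto
  finally show ?thesis .
qed

lemma sigma_finite_leb: "sigma_finite_measure (leb n)"
proof
  let ?C = "\<lambda>k::nat. {x::vec. \<forall>i<n. \<bar>x i - 0\<bar> < real k}"
  have "UNIV = \<Union>(range ?C)"
  proof (intro UNIV_eq_I)
    fix x :: vec
    obtain k :: nat where k: "(\<Sum>i<n. \<bar>x i\<bar>) < real k"
      using reals_Archimedean2 by blast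
    have "\<bar>x i\<bar> \<le> (\<Sum>i<n. \<bar>x i\<bar>)" if "i < n" for i
      using that member_le_sum[of i "{..<n}" "\<lambda>i. \<bar>x i\<bar>"] by simp
    then show "x \<in> \<Union>(range ?C)" using k by (auto intro!: exI[of _ k] dest: le_less_trans)
  qed
  moreover have "range ?C \<subseteq> sets (leb n)" by (auto; measurable)
  moreover have "emeasure (leb n) (?C k) \<noteq> \<infinity>" for k
    by (subst emeasure_leb_cube) auto
  ultimately show "\<exists>A. countable A \<and> A \<subseteq> sets (leb n) \<and> \<Union>A = space (leb n) \<and> (\<forall>a\<in>A. emeasure (leb n) a \<noteq> \<infinity>)"
    by (intro exI[of _ "range ?C"]) simp
qed

interpretation leb: sigma_finite_measure "leb n"
  by (rule sigma_finite_leb)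

lemma measurable_emeasure_slice [measurable]:
  assumes [measurable]: "A \<in> sets borel"
  shows "(\<lambda>t. emeasure (leb m) {x. x(m := t) \<in> A}) \<in> borel_measurable borel"
proof -
  have "(\<lambda>t. \<integral>\<^sup>+x. indicator A (x(m := t)) \<partial>leb m) \<in> borel_measurable borel"
    by (rule leb.borel_measurable_nn_integral) measurable
  moreover have "(\<integral>\<^sup>+x. indicator A (x(m := t)) \<partial>leb m) = emeasure (leb m) {x. x(m := t) \<in> A}" for t
  proof -
    have "(\<integral>\<^sup>+x. indicator A (x(m := t)) \<partial>leb m) = (\<integral>\<^sup>+x. indicator {x. x(m := t) \<in> A} x \<partial>leb m)"
      by (simp add: indicator_def)
    then show ?thesis by (simp add: pred_def)
  qed
  ultimately show ?thesis by simp
qed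

lemma AE_leb_Rn: "AE x in leb n. x \<in> Rn n"
proof (rule AE_I')
  have "emeasure (leb n) {x. \<exists>i\<ge>n. x i \<noteq> 0} = (\<integral>\<^sup>+x. indicator {x. \<exists>i\<ge>n. x i \<noteq> 0} x \<partial>leb n)"
    by (intro nn_integral_indicator[symmetric]) measurable
  also have "\<dots> = 0"
    by (subst nn_integral_leb) auto
  finally show "{x. \<exists>i\<ge>n. x i \<noteq> 0} \<in> null_sets (leb n)"
    by (auto simp: null_sets_def; measurable)
qed (auto simp: topspace_Euclidean_space)

lemma nn_integral_leb_translate:
  assumes "f \<in> borel_measurable borel" "v \<in> Rn n"
  shows "(\<integral>\<^sup>+x. f (\<lambda>i. x i + v i) \<partial>leb n) = (\<integral>\<^sup>+x. f x \<partial>leb n)"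
  using assms
proof (induction n arbitrary: f v)
  case 0
  then show ?case by (subst (1 2) nn_integral_leb_0) (auto simp: topspace_Euclidean_space intro!: measurable_compose[OF _ 0(1)] measurable_coordinatewise_then_product)
next
  case (Suc m)
  note [measurable] = Suc.prems(1)
  have [measurable]: "(\<lambda>x i. x i + w i) \<in> borel_measurable borel" for w :: vec
    by (intro measurable_coordinatewise_then_product) measurable
  let ?w = "v(m := 0)"
  have w: "?w \<in> Rn m" using Suc.prems(2) by (auto simp: topspace_Euclidean_space)
  have "(\<integral>\<^sup>+x. f (\<lambda>i. x i + v i) \<partial>leb (Suc m))
      = (\<integral>\<^sup>+t. (\<integral>\<^sup>+x. f (\<lambda>i. (x(m := t)) i + v i) \<partial>leb m) \<partial>lborel)"
    by (rule nn_integral_leb_Suc) measurable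
  also have "\<dots> = (\<integral>\<^sup>+t. (\<integral>\<^sup>+x. f ((\<lambda>i. x i + ?w i)(m := v m + t)) \<partial>leb m) \<partial>lborel)"
    by (intro nn_integral_cong arg_cong[where f = f]) auto
  also have "\<dots> = (\<integral>\<^sup>+t. (\<integral>\<^sup>+x. f (x(m := v m + t)) \<partial>leb m) \<partial>lborel)"
    using w by (intro nn_integral_cong Suc.IH[where f = "\<lambda>x. f (x(m := _))"]) measurable
  also have "\<dots> = (\<integral>\<^sup>+t. (\<integral>\<^sup>+x. f (x(m := t)) \<partial>leb m) \<partial>lborel)"
    by (subst lborel_distr_plus[of "v m", symmetric], subst nn_integral_distr)
       (auto intro!: leb.borel_measurable_nn_integral)
  also have "\<dots> = (\<integral>\<^sup>+x. f x \<partial>leb (Suc m))"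
    by (simp add: nn_integral_leb_Suc)
  finally show ?case .
qed

text \<open>
  If \<open>w\<close> depends on the last coordinate, a line in that direction meets the hyperplane in a single point;
  otherwise the slices are hyperplanes of one dimension less.
\<close>

lemma emeasure_leb_hyperplane:
  assumes "k < n" "w k \<noteq> 0"
  shows "emeasure (leb n) {x. (\<Sum>i<n. w i * x i) = c} = 0"
  using assms
proof (induction n arbitrary: c)
  case (Suc m)
  let ?A = "{x. (\<Sum>i<Suc m. w i * x i) = c}"
  have slice: "{x. x(m := t) \<in> ?A} = {x. (\<Sum>i<m. w i * x i) = c - w m * t}" for t
    by auto
  show ?case
  proof (cases "w m = 0")
    case True
    then have "k < m" using Suc.prems by (cases "k = m") auto
    have "emeasure (leb (Suc m)) ?A = (\<integral>\<^sup>+t. emeasure (leb m) {x. x(m := t) \<in> ?A} \<partial>lborel)"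
      by (rule emeasure_leb_Suc) measurable
    then show ?thesis using Suc.IH[OF \<open>k < m\<close> Suc.prems(2)] unfolding slice by simp
  next
    case False
    have "emeasure (leb (Suc m)) ?A = (\<integral>\<^sup>+x. indicator ?A x \<partial>leb (Suc m))"
      by (intro nn_integral_indicator[symmetric]) measurable
    also have "\<dots> = (\<integral>\<^sup>+t. (\<integral>\<^sup>+x. indicator ?A (x(m := t)) \<partial>leb m) \<partial>lborel)"
      by (rule nn_integral_leb_Suc) measurable
    also have "\<dots> = (\<integral>\<^sup>+x. (\<integral>\<^sup>+t. indicator ?A (x(m := t)) \<partial>lborel) \<partial>leb m)"
    proof -
      interpret pair_sigma_finite "leb m" "lborel :: real measure" ..
      show ?thesis by (rule Fubini') measurable
    qed
    also have "\<dots> = (\<integral>\<^sup>+x. (\<integral>\<^sup>+t. indicator {(c - (\<Sum>i<m. w i * x i)) / w m} t \<partial>lborel) \<partial>leb m)"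
      using False by (intro nn_integral_cong) (auto simp: indicator_def field_simps)
    also have "\<dots> = 0" by simp
    finally show ?thesis .
  qed
qed simp

section \<open>Orthonormal frames and invariance under orthogonal maps\<close>

text \<open>
  An open set of the product topology restricts only finitely many coordinates, so around each of its
  points it contains a cube in the first \<open>n\<close> coordinates; the others are fixed on \<open>Rn n\<close>.
\<close>

lemma emeasure_leb_pos:
  assumes "A \<in> sets borel" "Euclidean_space n interior_of A \<noteq> {}"
  shows "emeasure (leb n) A > 0"
proof -
  obtain c where c: "c \<in> Euclidean_space n interior_of A" using assms(2) by auto
  have "openin (subtopology (powertop_real UNIV) {x. \<forall>i\<ge>n. x i = 0}) (Euclidean_space n interior_of A)"
    using openin_interior_of[of "Euclidean_space n" A] by (simp add: Euclidean_space_def)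
  then obtain T where T: "openin (powertop_real UNIV) T"
      "Euclidean_space n interior_of A = T \<inter> {x. \<forall>i\<ge>n. x i = 0}"
    by (auto simp: openin_subtopology)
  obtain U where U: "\<And>i. open (U i)" "c \<in> Pi\<^sub>E UNIV U" "Pi\<^sub>E UNIV U \<subseteq> T"
    using T c unfolding openin_product_topology_alt by auto blast
  have "eventually (\<lambda>d. ball (c i) d \<subseteq> U i) (at_right 0)" for i
  proof -
    obtain d where "d > 0" "ball (c i) d \<subseteq> U i"
      using U(1,2) openE[of "U i" "c i"] by auto
    then show ?thesis
      unfolding eventually_at_right_field by (intro exI[of _ d]) (auto simp: subset_iff)
  qed
  then have "eventually (\<lambda>d. \<forall>i\<in>{..<n}. ball (c i) d \<subseteq> U i) (at_right 0)"
    by (intro eventually_ball_finite) auto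
  then have "eventually (\<lambda>d. d > 0 \<and> (\<forall>i\<in>{..<n}. ball (c i) d \<subseteq> U i)) (at_right 0)"
    using eventually_at_right_less[of "0::real"] by (rule eventually_conj[rotated])
  then obtain d where d: "d > 0" "\<And>i. i < n \<Longrightarrow> ball (c i) d \<subseteq> U i"
    using eventually_happens'[OF trivial_limit_at_right_real] by (metis (no_types, lifting) lessThan_iff)
  let ?C = "{x::vec. \<forall>i<n. \<bar>x i - c i\<bar> < d}"
  have sub: "x \<in> A" if "x \<in> ?C" "x \<in> Rn n" for x
  proof -
    have "x i \<in> U i" for i
    proof (cases "i < n")
      case True
      then show ?thesis using d(2)[of i] that(1) by (auto simp: dist_real_def abs_minus_commute)
    next
      case False
      have "c \<in> Rn n" using subsetD[OF interior_of_subset_topspace c] .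
      then have "x i = c i" using that(2) False by (auto simp: topspace_Euclidean_space)
      then show ?thesis using U(2) by auto
    qed
    then have "x \<in> T" using U(3) by auto
    then have "x \<in> Euclidean_space n interior_of A"
      using T(2) that(2) by (auto simp: topspace_Euclidean_space)
    then show ?thesis by (rule subsetD[OF interior_of_subset])
  qed
  have "0 < ennreal ((2 * d) ^ n)" using d(1) by simp
  also have "\<dots> = emeasure (leb n) ?C"
    using d(1) by (subst emeasure_leb_cube) auto
  also have "\<dots> \<le> emeasure (leb n) A"
    using AE_leb_Rn[of n] by (intro emeasure_mono_AE) (auto intro: sub simp: assms elim!: eventually_mono)
  finally show ?thesis .
qed

definition lincomb :: "nat \<Rightarrow> (nat \<Rightarrow> vec) \<Rightarrow> vec \<Rightarrow> vec" where
  "lincomb n b x = (\<lambda>i. \<Sum>j<n. x j * b j i)"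

definition orthonormal_frame :: "nat \<Rightarrow> (nat \<Rightarrow> vec) \<Rightarrow> bool" where
  "orthonormal_frame n b \<longleftrightarrow> (\<forall>j<n. b j \<in> Rn n) \<and>
     (\<forall>j<n. \<forall>k<n. dot n (b j) (b k) = (if j = k then 1 else 0))"

lemma lincomb_in_Rn: "orthonormal_frame n b \<Longrightarrow> lincomb n b x \<in> Rn n"
  by (simp add: orthonormal_frame_def lincomb_def topspace_Euclidean_space)

lemma measurable_lincomb [measurable]: "lincomb n b \<in> borel_measurable borel"
  unfolding lincomb_def by (intro measurable_coordinatewise_then_product) measurable

lemma dot_lincomb_left: "dot k (lincomb n b x) y = (\<Sum>j<n. x j * dot k (b j) y)"
  unfolding dot_def lincomb_def sum_distrib_right sum_distrib_left
  by (subst sum.swap) (simp add: mult.assoc)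

lemma dot_commute: "dot n x y = dot n y x"
  by (simp add: dot_def mult.commute)

lemma dot_lincomb_frame:
  assumes "orthonormal_frame n b" "j < n"
  shows "dot n (lincomb n b x) (b j) = x j"
proof -
  have "dot n (lincomb n b x) (b j) = (\<Sum>k<n. x k * (if k = j then 1 else 0))"
    unfolding dot_lincomb_left using assms by (intro sum.cong) (auto simp: orthonormal_frame_def)
  then show ?thesis using assms(2) by (simp add: if_distrib[of "(*) _"] cong: if_cong)
qed

lemma dot_lincomb_lincomb:
  assumes "orthonormal_frame n b"
  shows "dot n (lincomb n b x) (lincomb n b y) = dot n x y"
proof -
  have "dot n (lincomb n b x) (lincomb n b y) = (\<Sum>j<n. x j * dot n (lincomb n b y) (b j))"
    by (subst dot_lincomb_left) (simp add: dot_commute)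
  then show ?thesis using assms by (simp add: dot_lincomb_frame) (simp add: dot_def)
qed

text \<open>
  Orthonormal vectors \<open>b\<^sub>0, ..., b\<^bsub>n-1\<^esub>\<close> of \<open>\<real>\<^sup>n\<close> span it. The matrix \<open>P = \<Sum>\<^sub>j b\<^sub>j b\<^sub>j\<^sup>T\<close> of the projection onto
  their span has trace \<open>n\<close>, and the sum of the squares of its entries is \<open>n\<close> as well. Therefore the squared
  distance of \<open>P\<close> from the identity matrix, \<open>n - 2n + n\<close>, vanishes.
\<close>

lemma orthonormal_frame_expansion:
  assumes b: "orthonormal_frame n b" and y: "y \<in> Rn n"
  shows "lincomb n b (\<lambda>j. dot n y (b j)) = y"
proof
  fix i
  define P where "P k i = (\<Sum>j<n. b j k * b j i)" for k i
  let ?\<delta> = "\<lambda>k i::nat. if k = i then 1 else (0::real)"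
  have tr: "(\<Sum>k<n. P k k) = n"
  proof -
    have "(\<Sum>k<n. P k k) = (\<Sum>j<n. dot n (b j) (b j))"
      unfolding P_def dot_def by (rule sum.swap)
    then show ?thesis using b by (simp add: orthonormal_frame_def)
  qed
  have sq: "(\<Sum>k<n. \<Sum>i<n. P k i * P k i) = n"
  proof -
    have "(\<Sum>k<n. \<Sum>i<n. P k i * P k i) = (\<Sum>k<n. \<Sum>j<n. b j k * (\<Sum>i<n. b j i * P k i))"
    proof (rule sum.cong[OF refl])
      fix k
      have "(\<Sum>i<n. P k i * P k i) = (\<Sum>i<n. \<Sum>j<n. b j k * (b j i * P k i))"
        by (intro sum.cong refl, subst (1) P_def) (simp add: sum_distrib_right mult.assoc)
      also have "\<dots> = (\<Sum>j<n. b j k * (\<Sum>i<n. b j i * P k i))"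
        by (subst sum.swap) (simp add: sum_distrib_left)
      finally show "(\<Sum>i<n. P k i * P k i) = (\<Sum>j<n. b j k * (\<Sum>i<n. b j i * P k i))" .
    qed
    also have "\<dots> = (\<Sum>k<n. \<Sum>j<n. b j k * b j k)"
    proof (intro sum.cong refl)
      fix k j assume "j \<in> {..<n}"
      have "(\<Sum>i<n. b j i * P k i) = (\<Sum>l<n. b l k * dot n (b j) (b l))"
        unfolding P_def dot_def sum_distrib_left by (subst sum.swap) (simp add: mult_ac)
      also have "\<dots> = (\<Sum>l<n. b l k * (if j = l then 1 else 0))"
        using b \<open>j \<in> {..<n}\<close> by (intro sum.cong) (auto simp: orthonormal_frame_def)
      also have "\<dots> = b j k"
        using \<open>j \<in> {..<n}\<close> by (simp add: if_distrib[of "(*) _"] cong: if_cong)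
      finally show "b j k * (\<Sum>i<n. b j i * P k i) = b j k * b j k" by simp
    qed
    also have "\<dots> = (\<Sum>k<n. P k k)" by (simp add: P_def)
    finally show ?thesis using tr by simp
  qed
  have "(\<Sum>k<n. \<Sum>i<n. (?\<delta> k i - P k i)\<^sup>2) = (\<Sum>k<n. \<Sum>i<n. ?\<delta> k i - 2 * (?\<delta> k i * P k i) + P k i * P k i)"
    by (intro sum.cong refl) (auto simp: power2_eq_square algebra_simps)
  also have "\<dots> = (\<Sum>k<n. 1 - 2 * P k k) + (\<Sum>k<n. \<Sum>i<n. P k i * P k i)"
    by (simp add: sum.distrib sum_subtractf mult_if_delta flip: sum_distrib_left)
  also have "\<dots> = 0"
    using sq tr by (simp add: sum_subtractf flip: sum_distrib_left)
  finally have "(\<Sum>k<n. \<Sum>i<n. (?\<delta> k i - P k i)\<^sup>2) = 0" .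
  then have P: "P k i = ?\<delta> k i" if "k < n" "i < n" for k i
    using that by (simp add: sum_nonneg_eq_0_iff sum_nonneg)
  show "lincomb n b (\<lambda>j. dot n y (b j)) i = y i"
  proof (cases "i < n")
    case True
    have "lincomb n b (\<lambda>j. dot n y (b j)) i = (\<Sum>k<n. y k * P k i)"
      unfolding lincomb_def dot_def P_def sum_distrib_left sum_distrib_right
      by (subst sum.swap) (simp add: mult_ac)
    also have "\<dots> = (\<Sum>k<n. y k * ?\<delta> k i)" using True P by (intro sum.cong) auto
    also have "\<dots> = y i" using True by (simp add: if_distrib[of "(*) _"] cong: if_cong)
    finally show ?thesis .
  next
    case False
    then show ?thesis using lincomb_in_Rn[OF b] y by (simp add: topspace_Euclidean_space)
  qed
qed

lemma measurable_dot [measurable (raw)]: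
  assumes [measurable]: "f \<in> borel_measurable M" "g \<in> borel_measurable M"
  shows "(\<lambda>x. dot n (f x) (g x)) \<in> borel_measurable M"
  unfolding dot_def by measurable

lemma measurable_vec_add [measurable (raw)]:
  assumes [measurable]: "f \<in> borel_measurable M" "g \<in> borel_measurable M"
  shows "(\<lambda>x i. f x i + g x i :: real) \<in> M \<rightarrow>\<^sub>M (borel :: vec measure)"
  by (intro measurable_coordinatewise_then_product) measurable

lemma measurable_vec_diff [measurable (raw)]:
  assumes [measurable]: "f \<in> borel_measurable M" "g \<in> borel_measurable M"
  shows "(\<lambda>x i. f x i - g x i :: real) \<in> M \<rightarrow>\<^sub>M (borel :: vec measure)"
  by (intro measurable_coordinatewise_then_product) measurable

text \<open>
  Uniqueness of translation invariant measures. Let \<open>\<nu>\<close> be Lebesgue measure, \<open>\<mu>\<close> its image under the orthogonal map \<open>T\<close>,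
  and \<open>Q\<close> the unit ball. Integrate \<open>1\<^sub>A(x + y) 1\<^sub>Q(y)\<close> with respect to \<open>\<mu>\<close> in \<open>x\<close> and \<open>\<nu>\<close> in \<open>y\<close>. Invariance of \<open>\<mu>\<close> yields
  \<open>\<mu>(A) \<nu>(Q)\<close>. After the order of integration is exchanged, invariance of \<open>\<nu>\<close> yields \<open>\<nu>(A) \<mu>(Q)\<close>, and here
  \<open>\<mu>(Q) = \<nu>(Q)\<close> since the ball is symmetric and preserved by \<open>T\<close>. As \<open>0 < \<nu>(Q) < \<infinity>\<close>, the measures agree.
\<close>

lemma distr_leb_lincomb:
  assumes b: "orthonormal_frame n b"
  shows "distr (leb n) borel (lincomb n b) = leb n"
proof (rule measure_eqI)
  fix A assume "A \<in> sets (distr (leb n) borel (lincomb n b))"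
  then have [measurable]: "A \<in> sets borel" by simp
  let ?T = "lincomb n b"
  \<comment> \<open>An orthogonally invariant test set: this is what makes the factor between the two measures 1.\<close>
  define Q :: "vec set" where "Q = {x. dot n x x < 1}"
  have [measurable]: "Q \<in> sets borel" unfolding Q_def by measurable
  interpret pair_sigma_finite "leb n" "leb n" ..
  have coord: "\<exists>w\<in>Rn n. ?T w = y" if "y \<in> Rn n" for y
  proof (intro bexI)
    show "?T (\<lambda>j. if j < n then dot n y (b j) else 0) = y"
      using orthonormal_frame_expansion[OF b that] by (simp add: lincomb_def)
  qed (simp add: topspace_Euclidean_space)
  have Q_fin: "emeasure (leb n) Q \<noteq> \<infinity>"
  proof -
    have "\<bar>x i\<bar> \<le> 1" if "x \<in> Q" "i < n" for x i
    proof -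
      have "x i * x i \<le> dot n x x"
        unfolding dot_def using that by (intro member_le_sum) auto
      then have "(x i)\<^sup>2 \<le> 1" using that by (simp add: Q_def power2_eq_square)
      then show ?thesis by (simp add: abs_square_le_1)
    qed
    then show ?thesis using emeasure_leb_bounded[of Q n 1] by auto
  qed
  have Q_pos: "emeasure (leb n) Q \<noteq> 0"
  proof -
    \<comment> \<open>The cube of half side \<open>r\<close> lies in the ball as soon as \<open>n * r < 1\<close> and \<open>r \<le> 1\<close>.\<close>
    let ?r = "1 / (real n + 1)"
    have "{x. \<forall>i<n. \<bar>x i - 0\<bar> < ?r} \<subseteq> Q"
    proof
      fix x :: vec assume x: "x \<in> {x. \<forall>i<n. \<bar>x i - 0\<bar> < ?r}"
      have "dot n x x \<le> (\<Sum>i<n. ?r)"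
        unfolding dot_def
      proof (rule sum_mono)
        fix i assume "i \<in> {..<n}"
        then have "\<bar>x i\<bar> < ?r" using x by auto
        then have "\<bar>x i\<bar> * \<bar>x i\<bar> \<le> ?r * 1" by (intro mult_mono) (auto elim!: order_trans[OF less_imp_le])
        then show "x i * x i \<le> ?r" by simp
      qed
      also have "\<dots> < 1" by (simp add: field_simps)
      finally show "x \<in> Q" by (simp add: Q_def)
    qed
    then have "emeasure (leb n) {x. \<forall>i<n. \<bar>x i - 0\<bar> < ?r} \<le> emeasure (leb n) Q"
      by (intro emeasure_mono) auto
    moreover have "emeasure (leb n) {x. \<forall>i<n. \<bar>x i - 0\<bar> < ?r} > 0"
      by (subst emeasure_leb_cube) auto
    ultimately have "emeasure (leb n) Q > 0" by (rule less_le_trans[rotated])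
    then show ?thesis by simp
  qed
  have "emeasure (distr (leb n) borel ?T) A * emeasure (leb n) Q
      = (\<integral>\<^sup>+y. emeasure (distr (leb n) borel ?T) A * indicator Q y \<partial>leb n)"
    by (simp add: nn_integral_cmult)
  also have "\<dots> = (\<integral>\<^sup>+y. (\<integral>\<^sup>+x. indicator A (\<lambda>i. ?T x i + y i) * indicator Q y \<partial>leb n) \<partial>leb n)"
  proof (intro nn_integral_cong_AE eventually_mono[OF AE_leb_Rn])
    fix y assume "y \<in> Rn n"
    then obtain w where w: "w \<in> Rn n" "?T w = y" using coord by blast
    have "(\<integral>\<^sup>+x. indicator A (\<lambda>i. ?T x i + y i) \<partial>leb n) = (\<integral>\<^sup>+x. indicator A (?T (\<lambda>i. x i + w i)) \<partial>leb n)"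
      by (simp add: w(2)[symmetric] lincomb_def sum.distrib distrib_right)
    also have "\<dots> = (\<integral>\<^sup>+x. indicator A (?T x) \<partial>leb n)"
      by (rule nn_integral_leb_translate[of "\<lambda>x. indicator A (?T x)"]) (auto simp: w)
    also have "\<dots> = emeasure (distr (leb n) borel ?T) A"
      using nn_integral_distr[of ?T "leb n" borel "indicator A"] by simp
    finally show "emeasure (distr (leb n) borel ?T) A * indicator Q y
        = (\<integral>\<^sup>+x. indicator A (\<lambda>i. ?T x i + y i) * indicator Q y \<partial>leb n)"
      by (subst nn_integral_multc) auto
  qed
  also have "\<dots> = (\<integral>\<^sup>+x. (\<integral>\<^sup>+y. indicator A (\<lambda>i. ?T x i + y i) * indicator Q y \<partial>leb n) \<partial>leb n)"
    by (rule Fubini') measurable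
  also have "\<dots> = (\<integral>\<^sup>+x. (\<integral>\<^sup>+y. indicator A y * indicator Q (\<lambda>i. y i - ?T x i) \<partial>leb n) \<partial>leb n)"
  proof (rule nn_integral_cong)
    fix x
    show "(\<integral>\<^sup>+y. indicator A (\<lambda>i. ?T x i + y i) * indicator Q y \<partial>leb n)
        = (\<integral>\<^sup>+y. indicator A y * indicator Q (\<lambda>i. y i - ?T x i) \<partial>leb n)"
      using nn_integral_leb_translate[OF _ lincomb_in_Rn[OF b, of x],
          of "\<lambda>y. indicator A y * indicator Q (\<lambda>i. y i - ?T x i)"]
      by (simp add: add.commute)
  qed
  also have "\<dots> = (\<integral>\<^sup>+y. (\<integral>\<^sup>+x. indicator A y * indicator Q (\<lambda>i. y i - ?T x i) \<partial>leb n) \<partial>leb n)"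
    by (rule Fubini'[symmetric]) measurable
  also have "\<dots> = (\<integral>\<^sup>+y. indicator A y * emeasure (leb n) Q \<partial>leb n)"
  proof (intro nn_integral_cong_AE eventually_mono[OF AE_leb_Rn])
    fix y assume "y \<in> Rn n"
    then obtain w where w: "w \<in> Rn n" "?T w = y" using coord by blast
    have "(\<lambda>i. y i - ?T x i) \<in> Q \<longleftrightarrow> (\<lambda>i. x i + - w i) \<in> Q" for x
    proof -
      have "(\<lambda>i. y i - ?T x i) = ?T (\<lambda>i. w i - x i)"
        by (simp add: w(2)[symmetric] lincomb_def sum_subtractf left_diff_distrib)
      moreover have "dot n (\<lambda>i. w i - x i) (\<lambda>i. w i - x i) = dot n (\<lambda>i. x i + - w i) (\<lambda>i. x i + - w i)"
        unfolding dot_def by (intro sum.cong) (auto simp: algebra_simps)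
      ultimately show ?thesis by (simp add: Q_def dot_lincomb_lincomb[OF b])
    qed
    then have "(\<integral>\<^sup>+x. indicator Q (\<lambda>i. y i - ?T x i) \<partial>leb n) = (\<integral>\<^sup>+x. indicator Q (\<lambda>i. x i + - w i) \<partial>leb n)"
      by (simp add: indicator_def)
    also have "\<dots> = emeasure (leb n) Q"
      using nn_integral_leb_translate[of "indicator Q" "\<lambda>i. - w i" n] w(1)
      by (simp add: topspace_Euclidean_space)
    finally show "(\<integral>\<^sup>+x. indicator A y * indicator Q (\<lambda>i. y i - ?T x i) \<partial>leb n)
        = indicator A y * emeasure (leb n) Q"
      by (subst nn_integral_cmult) auto
  qed
  also have "\<dots> = emeasure (leb n) A * emeasure (leb n) Q"
    by (simp add: nn_integral_multc)
  finally show "emeasure (distr (leb n) borel ?T) A = emeasure (leb n) A"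
    using Q_fin Q_pos by (simp add: ennreal_mult_cancel_left mult.commute[of _ "emeasure (leb n) Q"])
qed simp

section \<open>The multiplicative Brunn-Minkowski inequality\<close>

text \<open>
  The one-dimensional Brunn-Minkowski inequality, for intervals. Endpoints need not belong to the
  intervals, so only the open interval between the combined endpoints is shown to lie in \<open>T\<close>.
\<close>

lemma emeasure_weighted_sum_intervals:
  fixes I J :: "real set"
  assumes I: "convex I" "I \<noteq> {}" "bounded I" and J: "convex J" "J \<noteq> {}" "bounded J"
    and T: "T \<in> sets borel"
    and ab: "\<alpha> > 0" "\<beta> > 0" "\<alpha> + \<beta> = 1"
    and sub: "\<And>x y. x \<in> I \<Longrightarrow> y \<in> J \<Longrightarrow> \<alpha> * x + \<beta> * y \<in> T"
  shows "ennreal \<alpha> * emeasure lborel I + ennreal \<beta> * emeasure lborel J \<le> emeasure lborel T"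
proof -
  have bdd: "bdd_above I" "bdd_below I" "bdd_above J" "bdd_below J"
    using I(3) J(3) by (auto intro: bounded_imp_bdd_above bounded_imp_bdd_below)
  define a b c d where "a = Inf I" "b = Sup I" "c = Inf J" "d = Sup J"
  note defs = this
  have IJ: "I \<subseteq> {a..b}" "J \<subseteq> {c..d}"
    using bdd by (auto simp: defs intro: cInf_lower cSup_upper)
  have le: "a \<le> b" "c \<le> d" using IJ I(2) J(2) by fastforce+
  have "{\<alpha> * a + \<beta> * c<..<\<alpha> * b + \<beta> * d} \<subseteq> T"
  proof
    fix p assume p: "p \<in> {\<alpha> * a + \<beta> * c<..<\<alpha> * b + \<beta> * d}"
    \<comment> \<open>Points of \<open>I\<close> and \<open>J\<close> this close to the endpoints give combinations on both sides of \<open>p\<close>;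
      moving along the segment between them hits \<open>p\<close>.\<close>
    define \<delta> where "\<delta> = min (p - (\<alpha> * a + \<beta> * c)) (\<alpha> * b + \<beta> * d - p)"
    have \<delta>: "\<delta> > 0" using p by (simp add: \<delta>_def)
    obtain x1 where x1: "x1 \<in> I" "x1 < a + \<delta>"
      using \<delta> I(2) bdd by (metis cInf_lessD defs(1) less_add_same_cancel1)
    obtain y1 where y1: "y1 \<in> J" "y1 < c + \<delta>"
      using \<delta> J(2) bdd by (metis cInf_lessD defs(3) less_add_same_cancel1)
    obtain x2 where x2: "x2 \<in> I" "b - \<delta> < x2"
      using \<delta> I(2) bdd less_cSupD[of I "b - \<delta>"] by (auto simp: defs)
    obtain y2 where y2: "y2 \<in> J" "d - \<delta> < y2"
      using \<delta> J(2) bdd less_cSupD[of J "d - \<delta>"] by (auto simp: defs)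
    define v1 v2 where "v1 = \<alpha> * x1 + \<beta> * y1" "v2 = \<alpha> * x2 + \<beta> * y2"
    have "v1 < \<alpha> * (a + \<delta>) + \<beta> * (c + \<delta>)"
      unfolding v1_v2_def using ab x1 y1 by (intro add_strict_mono mult_strict_left_mono) auto
    also have "\<dots> = \<alpha> * a + \<beta> * c + (\<alpha> + \<beta>) * \<delta>" by (simp add: algebra_simps)
    also have "\<dots> \<le> p" using ab by (simp add: \<delta>_def)
    finally have v1: "v1 < p" .
    have "p \<le> \<alpha> * b + \<beta> * d - (\<alpha> + \<beta>) * \<delta>" using ab by (simp add: \<delta>_def)
    also have "\<dots> = \<alpha> * (b - \<delta>) + \<beta> * (d - \<delta>)" by (simp add: algebra_simps)
    also have "\<dots> < v2"
      unfolding v1_v2_def using ab x2 y2 by (intro add_strict_mono mult_strict_left_mono) auto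
    finally have v2: "p < v2" .
    define t where "t = (p - v1) / (v2 - v1)"
    have t: "0 \<le> t" "t \<le> 1" "t * (v2 - v1) = p - v1"
      using v1 v2 by (auto simp: t_def)
    have "(1 - t) * x1 + t * x2 \<in> I" "(1 - t) * y1 + t * y2 \<in> J"
      using convexD_alt[OF I(1) x1(1) x2(1) t(1,2)] convexD_alt[OF J(1) y1(1) y2(1) t(1,2)] by auto
    then have "\<alpha> * ((1 - t) * x1 + t * x2) + \<beta> * ((1 - t) * y1 + t * y2) \<in> T" by (rule sub)
    also have "\<alpha> * ((1 - t) * x1 + t * x2) + \<beta> * ((1 - t) * y1 + t * y2) = v1 + t * (v2 - v1)"
      by (simp add: v1_v2_def algebra_simps)
    also have "\<dots> = p" using t(3) by simp
    finally show "p \<in> T" .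
  qed
  then have T': "emeasure lborel {\<alpha> * a + \<beta> * c<..<\<alpha> * b + \<beta> * d} \<le> emeasure lborel T"
    using T by (intro emeasure_mono) auto
  have "emeasure lborel I \<le> ennreal (b - a)" "emeasure lborel J \<le> ennreal (d - c)"
    using emeasure_mono[OF IJ(1), of lborel] emeasure_mono[OF IJ(2), of lborel] le by auto
  then have "ennreal \<alpha> * emeasure lborel I + ennreal \<beta> * emeasure lborel J
      \<le> ennreal \<alpha> * ennreal (b - a) + ennreal \<beta> * ennreal (d - c)"
    by (intro add_mono mult_left_mono) auto
  also have "\<dots> = ennreal ((\<alpha> * b + \<beta> * d) - (\<alpha> * a + \<beta> * c))"
    using ab le by (simp add: ennreal_mult[symmetric] ennreal_plus[symmetric] algebra_simps del: ennreal_plus)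
  also have "\<dots> \<le> emeasure lborel T"
    using T' ab le by (simp add: add_mono mult_left_mono)
  finally show ?thesis .
qed

text \<open>
  The one-dimensional Prekopa-Leindler inequality. After \<open>f\<close> and \<open>g\<close> are scaled to have supremum \<open>1\<close>, the
  superlevel sets of both at a height \<open>y\<close> are nonempty exactly for the same range \<open>y < 1\<close>, and their weighted sum
  lies in a superlevel set of \<open>h\<close>. Integrating the inequality for intervals over \<open>0 < y < 1\<close> bounds \<open>\<integral> h\<close>
  below by a weighted arithmetic mean, hence by the geometric mean. Without the scaling one of the two superlevel sets
  could be empty. Quasi-concavity of \<open>f\<close> and \<open>g\<close> makes the superlevel sets intervals.
\<close>

lemma prekopa_leindler_real:
  fixes f g :: "real \<Rightarrow> real" and h :: "real \<Rightarrow> ennreal"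
  assumes [measurable]: "f \<in> borel_measurable borel" "g \<in> borel_measurable borel" "h \<in> borel_measurable borel"
    and nonneg: "\<And>x. f x \<ge> 0" "\<And>x. g x \<ge> 0"
    and qc: "\<And>y. convex {x. f x > y}" "\<And>y. convex {x. g x > y}"
    and bd: "\<And>x. f x \<le> B" "\<And>x. g x \<le> B"
    and supp: "\<And>x. \<bar>x\<bar> > R \<Longrightarrow> f x = 0" "\<And>x. \<bar>x\<bar> > R \<Longrightarrow> g x = 0"
    and ab: "\<alpha> > 0" "\<beta> > 0" "\<alpha> + \<beta> = 1"
    and h: "\<And>x y. ennreal (f x powr \<alpha> * g y powr \<beta>) \<le> h (\<alpha> * x + \<beta> * y)"
    and int: "(\<integral>\<^sup>+x. ennreal (f x) \<partial>lborel) = ennreal a" "(\<integral>\<^sup>+x. ennreal (g x) \<partial>lborel) = ennreal b" "a \<ge> 0" "b \<ge> 0"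
  shows "ennreal (a powr \<alpha> * b powr \<beta>) \<le> (\<integral>\<^sup>+x. h x \<partial>lborel)"
proof (cases "a = 0 \<or> b = 0")
  case True
  then show ?thesis using ab by auto
next
  case False
  \<comment> \<open>A positive integral needs a positive value, so both suprema are positive.\<close>
  have "\<exists>x. f x \<noteq> 0"
  proof (rule ccontr)
    assume "\<nexists>x. f x \<noteq> 0"
    then show False using False int by simp
  qed
  moreover have "\<exists>x. g x \<noteq> 0"
  proof (rule ccontr)
    assume "\<nexists>x. g x \<noteq> 0"
    then show False using False int by simp
  qed
  ultimately obtain x0 y0 where x0y0: "f x0 > 0" "g y0 > 0"
    using nonneg by (metis less_eq_real_def)
  define F G where "F = (SUP x. f x)" "G = (SUP x. g x)"
  have bdd: "bdd_above (range f)" "bdd_above (range g)"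
    using bd by (auto intro!: bdd_aboveI[of _ B])
  have FG: "f x \<le> F" "g x \<le> G" for x
    unfolding F_G_def using bdd by (auto intro: cSUP_upper)
  have FG0: "F > 0" "G > 0" using FG[of x0] FG[of y0] x0y0 by auto
  define C where "C = F powr \<alpha> * G powr \<beta>"
  have C: "C > 0" using FG0 by (simp add: C_def)
  \<comment> \<open>Layer cake formulas: for a point, and integrated over the line.\<close>
  have layer: "(\<integral>\<^sup>+y. indicator {y. 0 < y \<and> y < 1 \<and> M * y < r} y \<partial>lborel) = ennreal (r / M)"
    if "0 < M" "0 \<le> r" "r \<le> M" for r M :: real
  proof -
    have "M * y < r \<longleftrightarrow> y < r / M" for y using that by (simp add: field_simps)
    moreover have "r / M \<le> 1" using that by simp
    ultimately have "{y. 0 < y \<and> y < 1 \<and> M * y < r} = {0<..<r / M}"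
      by (auto intro: less_le_trans)
    then show ?thesis using that by simp
  qed
  have level: "(\<integral>\<^sup>+y. indicator {0<..<1} y * emeasure lborel {x. M * y < k x} \<partial>lborel) = ennreal (c / M)"
    if "0 < M" "\<And>x. 0 \<le> k x" "\<And>x. k x \<le> M" "(\<integral>\<^sup>+x. ennreal (k x) \<partial>lborel) = ennreal c" "0 \<le> c"
      and [measurable]: "k \<in> borel_measurable borel" for M c and k :: "real \<Rightarrow> real"
  proof -
    have "(\<integral>\<^sup>+y. indicator {0<..<1} y * emeasure lborel {x. M * y < k x} \<partial>lborel)
        = (\<integral>\<^sup>+y. (\<integral>\<^sup>+x. indicator {y. 0 < y \<and> y < 1 \<and> M * y < k x} y \<partial>lborel) \<partial>lborel)"
    proof (rule nn_integral_cong)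
      fix y
      have "indicator {y. 0 < y \<and> y < 1 \<and> M * y < k x} y =
          (indicator {0<..<1} y * indicator {x. M * y < k x} x :: ennreal)" for x
        by (auto simp: indicator_def)
      then show "indicator {0<..<1} y * emeasure lborel {x. M * y < k x} =
          (\<integral>\<^sup>+x. indicator {y. 0 < y \<and> y < 1 \<and> M * y < k x} y \<partial>lborel)"
        by (simp add: nn_integral_cmult)
    qed
    also have "\<dots> = (\<integral>\<^sup>+x. (\<integral>\<^sup>+y. indicator {y. 0 < y \<and> y < 1 \<and> M * y < k x} y \<partial>lborel) \<partial>lborel)"
      by (rule lborel_pair.Fubini') (simp add: indicator_def[abs_def], measurable)
    also have "\<dots> = (\<integral>\<^sup>+x. ennreal (1 / M) * ennreal (k x) \<partial>lborel)"
      using that by (intro nn_integral_cong) (subst layer, auto simp flip: ennreal_mult)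
    also have "\<dots> = ennreal (c / M)"
      using that by (subst nn_integral_cmult) (auto simp flip: ennreal_mult)
    finally show ?thesis .
  qed
  have "ennreal (a powr \<alpha> * b powr \<beta>) = ennreal (C * ((a / F) powr \<alpha> * (b / G) powr \<beta>))"
    using FG0 int by (simp add: C_def powr_divide)
  also have "\<dots> \<le> ennreal (C * (\<alpha> * (a / F) + \<beta> * (b / G)))"
    using C FG0 ab False int by (intro ennreal_leI mult_left_mono Youngs_inequality_0) auto
  also have "\<dots> = ennreal C * (ennreal \<alpha> * ennreal (a / F) + ennreal \<beta> * ennreal (b / G))"
    using C FG0 ab int by (simp flip: ennreal_mult ennreal_plus)
  also have "\<dots> = ennreal C * (ennreal \<alpha> * (\<integral>\<^sup>+y. indicator {0<..<1} y * emeasure lborel {x. F * y < f x} \<partial>lborel)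
      + ennreal \<beta> * (\<integral>\<^sup>+y. indicator {0<..<1} y * emeasure lborel {x. G * y < g x} \<partial>lborel))"
    using FG0 FG nonneg int by (subst (1 2) level) auto
  also have "\<dots> = (\<integral>\<^sup>+y. ennreal C * (ennreal \<alpha> * (indicator {0<..<1} y * emeasure lborel {x. F * y < f x})
      + ennreal \<beta> * (indicator {0<..<1} y * emeasure lborel {x. G * y < g x})) \<partial>lborel)"
    by (simp add: nn_integral_cmult nn_integral_add)
  also have "\<dots> \<le> (\<integral>\<^sup>+y. ennreal C * (indicator {0<..<1} y * emeasure lborel {x. ennreal (C * y) < h x}) \<partial>lborel)"
  proof (intro nn_integral_mono mult_left_mono)
    fix y :: real
    show "ennreal \<alpha> * (indicator {0<..<1} y * emeasure lborel {x. F * y < f x})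
        + ennreal \<beta> * (indicator {0<..<1} y * emeasure lborel {x. G * y < g x})
        \<le> indicator {0<..<1} y * emeasure lborel {x. ennreal (C * y) < h x}"
    proof (cases "y \<in> {0<..<1}")
      case True
      have ne: "{x. F * y < f x} \<noteq> {}" "{x. G * y < g x} \<noteq> {}"
      proof -
        have "F * y < F" "G * y < G" using True FG0 by auto
        then show "{x. F * y < f x} \<noteq> {}" "{x. G * y < g x} \<noteq> {}"
          using bdd unfolding F_G_def by (auto simp: less_cSUP_iff)
      qed
      have bnd: "bounded {x. F * y < f x}" "bounded {x. G * y < g x}"
      proof -
        have pos: "F * y > 0" "G * y > 0" using True FG0 by auto
        have "\<bar>x\<bar> \<le> R" if "F * y < f x" for x
          using supp(1)[of x] that pos(1) by (cases "\<bar>x\<bar> > R") auto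
        moreover have "\<bar>x\<bar> \<le> R" if "G * y < g x" for x
          using supp(2)[of x] that pos(2) by (cases "\<bar>x\<bar> > R") auto
        ultimately have "{x. F * y < f x} \<subseteq> {-R..R}" "{x. G * y < g x} \<subseteq> {-R..R}"
          by (auto simp: abs_le_iff minus_le_iff)
        then show "bounded {x. F * y < f x}" "bounded {x. G * y < g x}"
          using bounded_subset bounded_closed_interval by blast+
      qed
      have "ennreal \<alpha> * emeasure lborel {x. F * y < f x} + ennreal \<beta> * emeasure lborel {x. G * y < g x}
          \<le> emeasure lborel {x. ennreal (C * y) < h x}"
      proof (rule emeasure_weighted_sum_intervals)
        fix x x' assume "x \<in> {x. F * y < f x}" "x' \<in> {x. G * y < g x}"
        then have *: "F * y < f x" "G * y < g x'" by auto
        have y0: "y > 0" using True by simp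
        have y1: "F * y > 0" "G * y > 0" using FG0 y0 by auto
        then have fg: "f x > 0" "g x' > 0" using * by linarith+
        have "C * y = C * y powr (\<alpha> + \<beta>)" using ab y0 by simp
        also have "\<dots> = (F * y) powr \<alpha> * (G * y) powr \<beta>"
          using FG0 y0 unfolding C_def by (simp add: powr_mult powr_add mult_ac)
        also have "\<dots> < f x powr \<alpha> * g x' powr \<beta>"
          using * y1 ab fg less_imp_le[OF y1(1)] less_imp_le[OF y1(2)]
          by (intro mult_strict_mono powr_less_mono2 powr_ge_zero) simp_all
        finally have "ennreal (C * y) < ennreal (f x powr \<alpha> * g x' powr \<beta>)"
          using C y0 fg by (intro ennreal_lessI) auto
        then show "\<alpha> * x + \<beta> * x' \<in> {x. ennreal (C * y) < h x}"
          using h[of x x'] by auto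
      qed (use ne bnd qc ab in auto)
      then show ?thesis using True by simp
    qed auto
  qed auto
  also have "\<dots> = (\<integral>\<^sup>+y. (\<integral>\<^sup>+x. ennreal C * indicator {y. 0 < y \<and> y < 1 \<and> ennreal (C * y) < h x} y \<partial>lborel) \<partial>lborel)"
  proof (rule nn_integral_cong)
    fix y
    have "indicator {y. 0 < y \<and> y < 1 \<and> ennreal (C * y) < h x} y =
        (indicator {0<..<1} y * indicator {x. ennreal (C * y) < h x} x :: ennreal)" for x
      by (auto simp: indicator_def)
    then show "ennreal C * (indicator {0<..<1} y * emeasure lborel {x. ennreal (C * y) < h x}) =
        (\<integral>\<^sup>+x. ennreal C * indicator {y. 0 < y \<and> y < 1 \<and> ennreal (C * y) < h x} y \<partial>lborel)"
      by (simp add: nn_integral_cmult)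
  qed
  also have "\<dots> = (\<integral>\<^sup>+x. (\<integral>\<^sup>+y. ennreal C * indicator {y. 0 < y \<and> y < 1 \<and> ennreal (C * y) < h x} y \<partial>lborel) \<partial>lborel)"
    by (rule lborel_pair.Fubini') (simp add: indicator_def[abs_def], measurable)
  also have "\<dots> \<le> (\<integral>\<^sup>+x. h x \<partial>lborel)"
  proof (rule nn_integral_mono)
    fix x
    show "(\<integral>\<^sup>+y. ennreal C * indicator {y. 0 < y \<and> y < 1 \<and> ennreal (C * y) < h x} y \<partial>lborel) \<le> h x"
    proof (cases "h x")
      case (real r)
      have "(\<integral>\<^sup>+y. ennreal C * indicator {y. 0 < y \<and> y < 1 \<and> ennreal (C * y) < h x} y \<partial>lborel)
          \<le> (\<integral>\<^sup>+y. ennreal C * indicator {0<..<r / C} y \<partial>lborel)"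
        using C real by (intro nn_integral_mono mult_left_mono)
          (auto simp: indicator_def ennreal_less_iff field_simps)
      also have "\<dots> = ennreal C * ennreal (r / C)"
        using C real by (simp add: nn_integral_cmult)
      also have "\<dots> = h x" using C real by (simp flip: ennreal_mult)
      finally show ?thesis .
    qed auto
  qed
  finally show ?thesis .
qed

lemma convex_setD:
  assumes "convex_set A" "x \<in> A" "y \<in> A" "0 \<le> \<alpha>" "0 \<le> \<beta>" "\<alpha> + \<beta> = 1"
  shows "(\<lambda>i. \<alpha> * x i + \<beta> * y i) \<in> A"
proof -
  have "(\<lambda>i. (1 - \<beta>) * x i + \<beta> * y i) \<in> A"
    using assms unfolding convex_set_def by auto
  moreover have "1 - \<beta> = \<alpha>" using assms by simp
  ultimately show ?thesis by simp
qed

lemma convex_setI: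
  assumes "\<And>x y \<alpha> \<beta>. x \<in> A \<Longrightarrow> y \<in> A \<Longrightarrow> 0 \<le> \<alpha> \<Longrightarrow> 0 \<le> \<beta> \<Longrightarrow> \<alpha> + \<beta> = 1 \<Longrightarrow> (\<lambda>i. \<alpha> * x i + \<beta> * y i) \<in> A"
  shows "convex_set A"
  unfolding convex_set_def using assms by auto

lemma slice_combination:
  "(\<lambda>i. \<alpha> * (x(m := s)) i + \<beta> * (y(m := t)) i) = (\<lambda>i. \<alpha> * x i + \<beta> * y i)(m := \<alpha> * s + \<beta> * t :: real)"
  by auto

lemma convex_set_slice: "convex_set A \<Longrightarrow> convex_set {x. x(m := t) \<in> A}"
proof (rule convex_setI)
  fix x y :: vec and \<alpha> \<beta> :: real
  assume A: "convex_set A" and xy: "x \<in> {x. x(m := t) \<in> A}" "y \<in> {x. x(m := t) \<in> A}"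
    and ab: "0 \<le> \<alpha>" "0 \<le> \<beta>" "\<alpha> + \<beta> = 1"
  have "\<alpha> * t + \<beta> * t = t" using ab(3) by (simp flip: distrib_right)
  then show "(\<lambda>i. \<alpha> * x i + \<beta> * y i) \<in> {x. x(m := t) \<in> A}"
    using convex_setD[OF A _ _ ab, of "x(m := t)" "y(m := t)"] xy unfolding slice_combination by simp
qed

lemma min_le_powr_mult:
  fixes p q :: real
  assumes "0 \<le> p" "0 \<le> q" "0 < \<alpha>" "0 < \<beta>" "\<alpha> + \<beta> = 1"
  shows "min p q \<le> p powr \<alpha> * q powr \<beta>"
proof -
  have "min p q = min p q powr \<alpha> * min p q powr \<beta>"
    using assms by (simp flip: powr_add)
  also have "\<dots> \<le> p powr \<alpha> * q powr \<beta>"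
    using assms by (intro mult_mono powr_mono2) auto
  finally show ?thesis .
qed

text \<open>
  Induction on the dimension. By the induction hypothesis the volumes of the slices of \<open>A\<close>, \<open>B\<close> and \<open>C\<close>
  orthogonal to the last coordinate satisfy the hypothesis of the Prekopa-Leindler inequality on the line. The induction
  hypothesis for two slices of the same convex set shows that the slice volume is log-concave, hence quasi-concave.
  The weights must therefore vary in the induction.
\<close>

theorem brunn_minkowski_multiplicative:
  assumes "A \<in> sets borel" "B \<in> sets borel" "C \<in> sets borel"
    and "convex_set A" "convex_set B"
    and "\<And>x i. x \<in> A \<Longrightarrow> i < m \<Longrightarrow> \<bar>x i\<bar> \<le> R" "\<And>x i. x \<in> B \<Longrightarrow> i < m \<Longrightarrow> \<bar>x i\<bar> \<le> R"
    and "\<alpha> > 0" "\<beta> > 0" "\<alpha> + \<beta> = 1"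
    and "\<And>x y. x \<in> A \<Longrightarrow> y \<in> B \<Longrightarrow> (\<lambda>i. \<alpha> * x i + \<beta> * y i) \<in> C"
  shows "ennreal (measure (leb m) A powr \<alpha> * measure (leb m) B powr \<beta>) \<le> emeasure (leb m) C"
  using assms
proof (induction m arbitrary: A B C \<alpha> \<beta>)
  case 0
  show ?case
  proof (cases "(\<lambda>_. 0) \<in> A \<and> (\<lambda>_. 0) \<in> B")
    case True
    then have "(\<lambda>_. 0) \<in> C" using "0.prems"(11)[of "\<lambda>_. 0" "\<lambda>_. 0"] by simp
    with True show ?thesis using "0.prems" by (simp add: measure_def emeasure_leb_0)
  next
    case False
    then show ?thesis using "0.prems" by (auto simp: measure_def emeasure_leb_0)
  qed
next
  case (Suc m)
  note [measurable] = Suc.prems(1-3)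
  note ab = Suc.prems(8-10)
  let ?s = "\<lambda>D t. {x::vec. x(m := t) \<in> D}"
  have [measurable]: "?s D t \<in> sets borel" if [measurable]: "D \<in> sets borel" for D t
    by measurable
  let ?f = "\<lambda>D t. measure (leb m) (?s D t)"
  define B0 where "B0 = measure (leb m) {x. \<forall>i<m. \<bar>x i\<bar> \<le> R}"
  have cube: "{x. \<forall>i<m. \<bar>x i\<bar> \<le> R} \<in> sets borel" by measurable
  have fin: "emeasure (leb m) (?s D t) < \<infinity>"
    if "\<forall>x\<in>D. \<forall>i<Suc m. \<bar>x i\<bar> \<le> R" for D t
  proof (rule emeasure_leb_bounded)
    fix x i assume "x \<in> ?s D t" "i < m"
    then show "\<bar>x i\<bar> \<le> R" using that[rule_format, of "x(m := t)" i] by simp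
  qed
  have step: "ennreal (?f D s powr \<gamma> * ?f E t powr \<delta>) \<le> emeasure (leb m) (?s F (\<gamma> * s + \<delta> * t))"
    if [measurable]: "D \<in> sets borel" "E \<in> sets borel" "F \<in> sets borel"
      and "convex_set D" "convex_set E" "\<gamma> > 0" "\<delta> > 0" "\<gamma> + \<delta> = 1"
      and bD: "\<And>x i. x \<in> D \<Longrightarrow> i < Suc m \<Longrightarrow> \<bar>x i\<bar> \<le> R" 
      and bE: "\<And>x i. x \<in> E \<Longrightarrow> i < Suc m \<Longrightarrow> \<bar>x i\<bar> \<le> R"
      and sub: "\<And>x y. x \<in> D \<Longrightarrow> y \<in> E \<Longrightarrow> (\<lambda>i. \<gamma> * x i + \<delta> * y i) \<in> F" for D E F \<gamma> \<delta> s t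
  proof (rule Suc.IH)
    fix x i assume "x \<in> ?s D s" "i < m"
    then show "\<bar>x i\<bar> \<le> R" using bD[of "x(m := s)" i] by simp
  next
    fix x i assume "x \<in> ?s E t" "i < m"
    then show "\<bar>x i\<bar> \<le> R" using bE[of "x(m := t)" i] by simp
  next
    fix x y assume "x \<in> ?s D s" "y \<in> ?s E t"
    then show "(\<lambda>i. \<gamma> * x i + \<delta> * y i) \<in> ?s F (\<gamma> * s + \<delta> * t)"
      using sub[of "x(m := s)" "y(m := t)"] unfolding slice_combination by simp
  qed (use that in \<open>auto intro: convex_set_slice\<close>)
  have meas: "?f D \<in> borel_measurable borel" if [measurable]: "D \<in> sets borel" for D
    unfolding measure_def by measurable
  have qc: "convex {t. ?f D t > y}"
    if D[measurable]: "D \<in> sets borel" and cD: "convex_set D"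
      and bD: "\<And>x i. x \<in> D \<Longrightarrow> i < Suc m \<Longrightarrow> \<bar>x i\<bar> \<le> R" for D y
  proof (rule convexI)
    fix s t u v :: real
    assume st: "s \<in> {t. ?f D t > y}" "t \<in> {t. ?f D t > y}" and uv: "0 \<le> u" "0 \<le> v" "u + v = 1"
    show "u *\<^sub>R s + v *\<^sub>R t \<in> {t. ?f D t > y}"
    proof (cases "u = 0 \<or> v = 0")
      case True
      then show ?thesis using st uv by auto
    next
      case False
      have "ennreal (?f D s powr u * ?f D t powr v) \<le> emeasure (leb m) (?s D (u * s + v * t))"
        using False uv D cD bD by (intro step) (auto intro: convex_setD)
      also have "\<dots> = ennreal (?f D (u * s + v * t))"
        using bD by (intro emeasure_eq_ennreal_measure less_imp_neq fin[unfolded infinity_ennreal_def]) auto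
      finally have "?f D s powr u * ?f D t powr v \<le> ?f D (u * s + v * t)"
        by simp
      moreover have "min (?f D s) (?f D t) \<le> ?f D s powr u * ?f D t powr v"
        using False uv by (intro min_le_powr_mult) auto
      ultimately show ?thesis using st by auto
    qed
  qed
  have B0: "?f D t \<le> B0"
    if [measurable]: "D \<in> sets borel" and bD: "\<And>x i. x \<in> D \<Longrightarrow> i < Suc m \<Longrightarrow> \<bar>x i\<bar> \<le> R" for D t
    unfolding B0_def
  proof (rule measure_mono_fmeasurable)
    show "?s D t \<subseteq> {x. \<forall>i<m. \<bar>x i\<bar> \<le> R}"
    proof safe
      fix x i assume "x(m := t) \<in> D" "i < m"
      then show "\<bar>x i\<bar> \<le> R" using bD[of "x(m := t)" i] by simp
    qed
    show "{x. \<forall>i<m. \<bar>x i\<bar> \<le> R} \<in> fmeasurable (leb m)"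
      using cube emeasure_leb_bounded[of "{x. \<forall>i<m. \<bar>x i\<bar> \<le> R}" m R] by (auto simp: fmeasurable_def)
  qed simp
  have supp: "?f D t = 0" if "\<bar>t\<bar> > R" and bD: "\<And>x i. x \<in> D \<Longrightarrow> i < Suc m \<Longrightarrow> \<bar>x i\<bar> \<le> R" for D t
  proof -
    have "?s D t = {}" using that(1) bD[of "_(m := t)" m] by force
    then show ?thesis by simp
  qed
  have tot: "(\<integral>\<^sup>+t. ennreal (?f D t) \<partial>lborel) = ennreal (measure (leb (Suc m)) D)"
    if [measurable]: "D \<in> sets borel" and bD: "\<And>x i. x \<in> D \<Longrightarrow> i < Suc m \<Longrightarrow> \<bar>x i\<bar> \<le> R" for D
  proof -
    have "ennreal (?f D t) = emeasure (leb m) (?s D t)" for t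
      using bD by (intro emeasure_eq_ennreal_measure[symmetric] less_imp_neq fin[unfolded infinity_ennreal_def]) auto
    then have "(\<integral>\<^sup>+t. ennreal (?f D t) \<partial>lborel) = emeasure (leb (Suc m)) D"
      by (simp add: emeasure_leb_Suc)
    also have "\<dots> = ennreal (measure (leb (Suc m)) D)"
      using emeasure_leb_bounded[of D "Suc m" R] bD by (intro emeasure_eq_ennreal_measure) auto
    finally show ?thesis .
  qed
  have "ennreal (measure (leb (Suc m)) A powr \<alpha> * measure (leb (Suc m)) B powr \<beta>)
      \<le> (\<integral>\<^sup>+t. emeasure (leb m) (?s C t) \<partial>lborel)"
    by (rule prekopa_leindler_real[of "?f A" "?f B" _ B0 R])
       (use Suc.prems in \<open>auto intro!: meas qc B0 step tot intro: supp\<close>)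
  then show ?case by (simp add: emeasure_leb_Suc)
qed

section \<open>Half spaces through the centroid\<close>

lemma nn_integral_exp_decay:
  fixes a p :: real
  assumes "a > 0" "p \<ge> 0"
  shows "(\<integral>\<^sup>+r. ennreal (p * exp (- r / a)) * indicator {0..} r \<partial>lborel) = ennreal (p * a)"
proof -
  have "((\<lambda>r. exp (- r / a)) \<longlongrightarrow> 0) at_top"
  proof (rule filterlim_compose[OF exp_at_bot])
    have "filterlim (\<lambda>r. - (r / a)) at_bot at_top"
      using assms filterlim_tendsto_pos_mult_at_top[OF tendsto_const, of "1 / a" "\<lambda>r. r" at_top]
      by (intro filterlim_compose[OF filterlim_uminus_at_bot_at_top]) (simp add: filterlim_ident)
    then show "filterlim (\<lambda>r. - r / a) at_bot at_top" by simp
  qed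
  then have "((\<lambda>r. - p * a * exp (- r / a)) \<longlongrightarrow> 0) at_top"
    by (rule tendsto_mult_right_zero)
  then have "(\<integral>\<^sup>+r. ennreal (p * exp (- r / a)) * indicator {0..} r \<partial>lborel) = ennreal (0 - (- p * a * exp (- 0 / a)))"
    using assms
    by (intro nn_integral_FTC_atLeast) (auto intro!: derivative_eq_intros)
  then show ?thesis by simp
qed

lemma linear_form_combination:
  fixes w x y :: vec
  shows "(\<Sum>i<n. w i * (\<alpha> * x i + \<beta> * y i)) = \<alpha> * (\<Sum>i<n. w i * x i) + \<beta> * (\<Sum>i<n. w i * y i)"
proof -
  have "(\<Sum>i<n. w i * (\<alpha> * x i + \<beta> * y i)) = (\<Sum>i<n. \<alpha> * (w i * x i) + \<beta> * (w i * y i))"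
    by (intro sum.cong refl) (simp add: algebra_simps)
  then show ?thesis by (simp add: sum.distrib sum_distrib_left)
qed

lemma convex_set_half_space:
  assumes "convex_set K"
  shows "convex_set {x\<in>K. r < (\<Sum>i<n. w i * x i)}"
proof (rule convex_setI)
  fix x y :: vec and \<alpha> \<beta> :: real
  assume xy: "x \<in> {x\<in>K. r < (\<Sum>i<n. w i * x i)}" "y \<in> {x\<in>K. r < (\<Sum>i<n. w i * x i)}"
    and ab: "0 \<le> \<alpha>" "0 \<le> \<beta>" "\<alpha> + \<beta> = 1"
  have "r < \<alpha> * (\<Sum>i<n. w i * x i) + \<beta> * (\<Sum>i<n. w i * y i)"
    using xy ab convexD[OF convex_real_interval(3)[of r], of "\<Sum>i<n. w i * x i" "\<Sum>i<n. w i * y i" \<alpha> \<beta>] by simp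
  then show "(\<lambda>i. \<alpha> * x i + \<beta> * y i) \<in> {x\<in>K. r < (\<Sum>i<n. w i * x i)}"
    using convex_setD[OF assms, of x y \<alpha> \<beta>] xy ab by (simp add: linear_form_combination)
qed

text \<open>
  A dimension-free weak form of Gruenbaum's inequality, with \<open>1/4\<close> in place of \<open>1/e\<close>. Let \<open>l\<close> be the linear form,
  \<open>M = |K|\<close> and \<open>P r = |K \<inter> {l > r}|\<close>. Since the centroid is \<open>0\<close>, the positive and the negative part of \<open>l\<close> have the
  same integral \<open>\<iota>\<close> over \<open>K\<close>. Markov's inequality gives \<open>P (-a) \<ge> 3M/4\<close> for \<open>a = 4\<iota>/M\<close>. If \<open>p = P 0\<close> were smaller
  than \<open>M/4\<close>, then \<open>P\<close>, being log-concave, would have dropped by the factor \<open>3 \<ge> e\<close> on \<open>[-a, 0]\<close> and thus would satisfy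
  \<open>P r \<le> p * exp (-r/a)\<close> for \<open>r > 0\<close>. Integrating, \<open>\<iota> \<le> p * a = 4 * \<iota> * p / M\<close>, which contradicts \<open>p < M/4\<close>.
\<close>

theorem half_space_through_centroid:
  assumes [measurable]: "K \<in> sets borel" and conv: "convex_set K"
    and bd: "\<And>x i. x \<in> K \<Longrightarrow> i < n \<Longrightarrow> \<bar>x i\<bar> \<le> R"
    and centered: "\<And>j. j < n \<Longrightarrow> (LINT x:K|leb n. x j) = 0"
    and w: "k < n" "w k \<noteq> 0"
  shows "measure (leb n) K / 4 \<le> measure (leb n) {x\<in>K. 0 < (\<Sum>i<n. w i * x i)}"
proof (rule ccontr)
  assume contra: "\<not> ?thesis"
  define l where "l x = (\<Sum>i<n. w i * x i)" for x :: vec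
  have [measurable]: "l \<in> borel_measurable borel" unfolding l_def by measurable
  define M where "M = measure (leb n) K"
  define P where "P r = measure (leb n) {x\<in>K. r < l x}" for r
  define p where "p = P 0"
  have p: "p < M / 4" "0 \<le> p" using contra by (simp_all add: p_def P_def M_def l_def)
  then have M: "M > 0" by simp
  have fin: "emeasure (leb n) A < \<infinity>" if "A \<subseteq> K" for A
    using that bd by (intro emeasure_leb_bounded[of _ _ R]) auto
  have eP: "emeasure (leb n) {x\<in>K. r < l x} = ennreal (P r)" for r
    unfolding P_def using fin[of "{x\<in>K. r < l x}"] by (intro emeasure_eq_ennreal_measure) auto
  have eM: "emeasure (leb n) K = ennreal M"
    unfolding M_def using fin[of K] by (intro emeasure_eq_ennreal_measure) auto
  define W where "W = (\<Sum>i<n. \<bar>w i\<bar> * \<bar>R\<bar>)"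
  have lW: "\<bar>l x\<bar> \<le> W" if "x \<in> K" for x
  proof -
    have "\<bar>l x\<bar> \<le> (\<Sum>i<n. \<bar>w i * x i\<bar>)" unfolding l_def by (rule sum_abs)
    also have "\<dots> \<le> W" unfolding W_def
      using bd[OF that] by (intro sum_mono) (auto simp: abs_mult intro!: mult_left_mono intro: order_trans[OF _ abs_ge_self])
    finally show ?thesis .
  qed
  \<comment> \<open>The values are extended nonnegative reals and \<^const>\<open>ennreal\<close> sends negative numbers to \<open>0\<close>,
    so these are the integrals of the positive and the negative part of \<open>l\<close> over \<open>K\<close>.\<close>
  define I J where "I = (\<integral>\<^sup>+x. ennreal (indicator K x * l x) \<partial>leb n)"
    and "J = (\<integral>\<^sup>+x. ennreal (- (indicator K x * l x)) \<partial>leb n)"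
  have bdd_int: "(\<integral>\<^sup>+x. ennreal (g x) \<partial>leb n) < \<infinity>"
    if "\<And>x. x \<in> K \<Longrightarrow> g x \<le> B" "\<And>x. x \<notin> K \<Longrightarrow> g x = 0" for g :: "vec \<Rightarrow> real" and B
  proof -
    have "(\<integral>\<^sup>+x. ennreal (g x) \<partial>leb n) \<le> (\<integral>\<^sup>+x. ennreal B * indicator K x \<partial>leb n)"
      using that by (intro nn_integral_mono) (auto simp: indicator_def intro: ennreal_leI)
    also have "\<dots> = ennreal B * ennreal M" by (simp add: nn_integral_cmult eM)
    also have "\<dots> < \<infinity>" by (simp add: ennreal_mult_less_top)
    finally show ?thesis .
  qed
  have Ifin: "I < \<infinity>" "J < \<infinity>"
    unfolding I_def J_def by (rule bdd_int[of _ W]; use lW in \<open>auto simp: abs_le_iff\<close>)+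
  have IJ: "I = J"
  proof -
    have int: "integrable (leb n) (\<lambda>x. indicator K x * x j)" if "j < n" for j
    proof (rule integrableI_bounded)
      show "(\<integral>\<^sup>+x. ennreal (norm (indicator K x * x j :: real)) \<partial>leb n) < \<infinity>"
        using bd that by (intro bdd_int[of _ R]) (auto simp: indicator_def)
    qed measurable
    have "(LINT x|leb n. indicator K x * l x) = (LINT x|leb n. (\<Sum>j<n. w j * (indicator K x * x j)))"
      by (simp add: l_def sum_distrib_left mult_ac)
    also have "\<dots> = (\<Sum>j<n. w j * (LINT x:K|leb n. x j))"
      using int by (subst Bochner_Integration.integral_sum) (auto simp: set_lebesgue_integral_def)
    also have "\<dots> = 0" using centered by simp
    finally have "(LINT x|leb n. indicator K x * l x) = 0" .
    moreover have "integrable (leb n) (\<lambda>x. indicator K x * l x)"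
    proof (rule integrableI_bounded)
      show "(\<integral>\<^sup>+x. ennreal (norm (indicator K x * l x :: real)) \<partial>leb n) < \<infinity>"
        using lW by (intro bdd_int[of _ W]) (auto simp: indicator_def)
    qed measurable
    ultimately have "enn2real I = enn2real J"
      unfolding I_def J_def by (simp add: real_lebesgue_integral_def)
    then show ?thesis using Ifin by (cases I; cases J) auto
  qed
  define \<iota> where "\<iota> = enn2real I"
  have I\<iota>: "I = ennreal \<iota>" "J = ennreal \<iota>"
    using Ifin IJ by (simp_all add: \<iota>_def)
  \<comment> \<open>Otherwise \<open>K\<close> would lie in the hyperplane \<open>l = 0\<close> up to a null set.\<close>
  have "I \<noteq> 0"
  proof
    assume "I = 0"
    then have "J = 0" using IJ by simp
    have "AE x in leb n. ennreal (indicator K x * l x) = 0"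
      using \<open>I = 0\<close> unfolding I_def by (subst (asm) nn_integral_0_iff_AE) measurable
    moreover have "AE x in leb n. ennreal (- (indicator K x * l x)) = 0"
      using \<open>J = 0\<close> unfolding J_def by (subst (asm) nn_integral_0_iff_AE) measurable
    ultimately have "AE x in leb n. x \<in> K \<longrightarrow> x \<in> {x. (\<Sum>i<n. w i * x i) = 0}"
    proof eventually_elim
      case (elim x)
      then show ?case by (auto simp: l_def ennreal_eq_0_iff)
    qed
    then have "emeasure (leb n) K \<le> emeasure (leb n) {x. (\<Sum>i<n. w i * x i) = 0}"
      by (intro emeasure_mono_AE) measurable
    then show False using emeasure_leb_hyperplane[where w = w and c = 0, OF w] eM M by simp
  qed
  then have "\<iota> \<noteq> 0" using I\<iota>(1) by (metis ennreal_0)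
  moreover have "\<iota> \<ge> 0" unfolding \<iota>_def by (rule enn2real_nonneg)
  ultimately have \<iota>: "\<iota> > 0" by simp
  define a where "a = 4 * \<iota> / M"
  have a: "a > 0" using \<iota> M by (simp add: a_def)
  have Pa: "P (- a) \<ge> 3 / 4 * M"
  proof -
    have "ennreal a * emeasure (leb n) {x\<in>K. \<not> - a < l x} = (\<integral>\<^sup>+x. ennreal a * indicator {x\<in>K. \<not> - a < l x} x \<partial>leb n)"
      by (simp add: nn_integral_cmult)
    also have "\<dots> \<le> J"
      unfolding I_def J_def by (intro nn_integral_mono) (auto simp: indicator_def intro: ennreal_leI)
    finally have "ennreal (a * measure (leb n) {x\<in>K. \<not> - a < l x}) \<le> ennreal \<iota>"
      using fin[of "{x\<in>K. \<not> - a < l x}"] a by (simp add: emeasure_eq_ennreal_measure ennreal_mult I\<iota>)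
    then have "measure (leb n) {x\<in>K. \<not> - a < l x} \<le> M / 4"
      using \<iota> M a by (simp add: a_def field_simps)
    moreover have "M = P (- a) + measure (leb n) {x\<in>K. \<not> - a < l x}"
    proof -
      have "ennreal M = emeasure (leb n) ({x\<in>K. - a < l x} \<union> {x\<in>K. \<not> - a < l x})"
        by (subst eM[symmetric]) (rule arg_cong[where f = "emeasure (leb n)"], auto)
      also have "\<dots> = emeasure (leb n) {x\<in>K. - a < l x} + emeasure (leb n) {x\<in>K. \<not> - a < l x}"
        by (rule plus_emeasure[symmetric]) (measurable, blast)
      also have "\<dots> = ennreal (P (- a) + measure (leb n) {x\<in>K. \<not> - a < l x})"
        using fin[of "{x\<in>K. \<not> - a < l x}"] by (simp add: eP emeasure_eq_ennreal_measure P_def)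
      finally show ?thesis using M by (subst (asm) ennreal_inj) (auto simp: P_def)
    qed
    ultimately show ?thesis by simp
  qed
  have decay: "P r \<le> p * exp (- r / a)" if r: "r > 0" for r
  proof (cases "P r = 0")
    case True
    then show ?thesis using p by simp
  next
    case False
    then have Pr: "P r > 0" by (simp add: P_def zero_less_measure_iff)
    have Pr_p: "P r \<le> p"
    proof -
      have "ennreal (P r) \<le> ennreal p"
        unfolding p_def eP[symmetric] using r by (intro emeasure_mono) (auto, measurable)
      then show ?thesis using p by simp
    qed
    then have p0: "p > 0" using Pr by simp
    \<comment> \<open>The weights for which \<open>0\<close> is the combination of \<open>-a\<close> and \<open>r\<close>.\<close>
    define \<alpha> \<beta> where "\<alpha> = r / (a + r)" "\<beta> = a / (a + r)"
    have ab: "\<alpha> > 0" "\<beta> > 0" "\<alpha> + \<beta> = 1" "\<alpha> * (- a) + \<beta> * r = 0"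
      using r a by (auto simp: \<alpha>_\<beta>_def add_divide_distrib[symmetric] field_simps)
    have "ennreal (P (- a) powr \<alpha> * P r powr \<beta>) \<le> emeasure (leb n) {x\<in>K. 0 < l x}"
      unfolding P_def
    proof (rule brunn_minkowski_multiplicative)
      show "convex_set {x\<in>K. - a < l x}" "convex_set {x\<in>K. r < l x}"
        unfolding l_def by (intro convex_set_half_space conv)+
      fix x y assume x: "x \<in> {x\<in>K. - a < l x}" and y: "y \<in> {x\<in>K. r < l x}"
      have "\<alpha> * (- a) + \<beta> * r < \<alpha> * l x + \<beta> * l y"
        using x y ab by (intro add_strict_mono mult_strict_left_mono) auto
      then have "0 < l (\<lambda>i. \<alpha> * x i + \<beta> * y i)"
        using ab by (simp add: l_def linear_form_combination)
      then show "(\<lambda>i. \<alpha> * x i + \<beta> * y i) \<in> {x\<in>K. 0 < l x}"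
        using convex_setD[OF conv, of x y \<alpha> \<beta>] x y ab by simp
    next
      show "{x\<in>K. - a < l x} \<in> sets borel" "{x\<in>K. r < l x} \<in> sets borel" "{x\<in>K. 0 < l x} \<in> sets borel"
        by measurable
    qed (use bd ab in auto)
    then have "P (- a) powr \<alpha> * P r powr \<beta> \<le> p"
      using p by (simp add: eP p_def)
    moreover have Pa0: "P (- a) > 0" using Pa M by simp
    ultimately have "ln (P (- a) powr \<alpha> * P r powr \<beta>) \<le> ln p"
      using Pr by (intro ln_mono) auto
    then have "\<alpha> * ln (P (- a)) + \<beta> * ln (P r) \<le> ln p"
      using Pa0 Pr by (simp add: ln_mult ln_powr)
    then have "(a + r) * (\<alpha> * ln (P (- a)) + \<beta> * ln (P r)) \<le> (a + r) * ln p"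
      using a r by (intro mult_left_mono) auto
    moreover have "(a + r) * \<alpha> = r" "(a + r) * \<beta> = a"
      using a r by (auto simp: \<alpha>_\<beta>_def)
    ultimately have "r * ln (P (- a)) + a * ln (P r) \<le> (a + r) * ln p"
      by (simp add: distrib_left mult.assoc[symmetric])
    moreover have "ln p + 1 \<le> ln (P (- a))"
    proof -
      have "p * exp 1 \<le> p * 3" using exp_le p by (intro mult_left_mono) auto
      also have "\<dots> \<le> P (- a)" using p Pa by simp
      finally have "ln (p * exp 1) \<le> ln (P (- a))" using p0 by (intro ln_mono) auto
      then show ?thesis using p0 by (simp add: ln_mult)
    qed
    then have "r * (ln p + 1) \<le> r * ln (P (- a))" using r by (intro mult_left_mono) auto
    ultimately have "a * ln (P r) \<le> a * (ln p - r / a)"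
      using a by (simp add: algebra_simps)
    then have "ln (P r) \<le> ln p - r / a" using a by simp
    then have "exp (ln (P r)) \<le> exp (ln p - r / a)" by simp
    then show ?thesis using Pr p0 by (simp add: exp_diff exp_minus divide_inverse)
  qed
  have "I = (\<integral>\<^sup>+x. (\<integral>\<^sup>+r. indicator {r. 0 < r \<and> x \<in> K \<and> r < l x} r \<partial>lborel) \<partial>leb n)"
    unfolding I_def J_def
  proof (rule nn_integral_cong)
    fix x
    show "ennreal (indicator K x * l x) = (\<integral>\<^sup>+r. indicator {r. 0 < r \<and> x \<in> K \<and> r < l x} r \<partial>lborel)"
    proof (cases "x \<in> K \<and> 0 \<le> l x")
      case True
      then have "{r. 0 < r \<and> x \<in> K \<and> r < l x} = {0<..<l x}" by auto
      then show ?thesis using True by simp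
    next
      case False
      then have "{r. 0 < r \<and> x \<in> K \<and> r < l x} = {}" by auto
      moreover have "ennreal (indicator K x * l x) = 0"
        using False by (cases "x \<in> K") (auto intro: ennreal_neg)
      ultimately show ?thesis by simp
    qed
  qed
  also have "\<dots> = (\<integral>\<^sup>+r. (\<integral>\<^sup>+x. indicator {r. 0 < r \<and> x \<in> K \<and> r < l x} r \<partial>leb n) \<partial>lborel)"
  proof -
    interpret pair_sigma_finite "leb n" "lborel :: real measure" ..
    show ?thesis by (rule Fubini'[symmetric]) (simp add: indicator_def[abs_def], measurable)
  qed
  also have "\<dots> \<le> (\<integral>\<^sup>+r. ennreal (p * exp (- r / a)) * indicator {0..} r \<partial>lborel)"
  proof (rule nn_integral_mono)
    fix r
    have "(\<integral>\<^sup>+x. indicator {r. 0 < r \<and> x \<in> K \<and> r < l x} r \<partial>leb n)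
        = (\<integral>\<^sup>+x. indicator {0<..} r * indicator {x\<in>K. r < l x} x \<partial>leb n)"
      by (intro nn_integral_cong) (auto simp: indicator_def)
    also have "\<dots> = indicator {0<..} r * ennreal (P r)"
      by (simp add: nn_integral_cmult eP)
    also have "\<dots> \<le> ennreal (p * exp (- r / a)) * indicator {0..} r"
      using decay by (auto simp: indicator_def intro: ennreal_leI)
    finally show "(\<integral>\<^sup>+x. indicator {r. 0 < r \<and> x \<in> K \<and> r < l x} r \<partial>leb n)
        \<le> ennreal (p * exp (- r / a)) * indicator {0..} r" .
  qed
  also have "\<dots> = ennreal (p * a)" using a p by (intro nn_integral_exp_decay)
  finally have "\<iota> \<le> p * a" using p a by (simp add: I\<iota>)
  then show False using \<iota> M p by (simp add: a_def field_simps)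
qed

section \<open>Half sections through the centroid\<close>

text \<open>
  The half section in coordinates adapted to the hyperplane: the last coordinate is the distance \<open>s\<close> from the section.
  The convex set \<open>{\<Phi> > \<eta>}\<close> is separated from the origin by a linear form \<open>\<alpha> s + \<beta> \<tau>\<close>; this yields a half space with boundary
  through the centroid whose slices all have volume at most \<open>\<eta>\<close>, so that it has little volume if \<open>\<eta>\<close> is small.
  It has at least a quarter of the volume, and this bounds \<open>\<eta>\<close> from below.
\<close>

theorem section_half_through_centroid:
  assumes [measurable]: "K \<in> sets borel" and conv: "convex_set K"
    and bd: "\<And>x i. x \<in> K \<Longrightarrow> i < Suc m \<Longrightarrow> \<bar>x i\<bar> \<le> R"
    and pos: "measure (leb (Suc m)) K > 0"
    and centered: "\<And>j. j < Suc m \<Longrightarrow> (LINT x:K|leb (Suc m). x j) = 0"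
  shows "measure (leb m) {x. x(m := 0) \<in> K} / 64
      \<le> measure (leb m) {x. x(m := 0) \<in> K \<and> 0 \<le> (\<Sum>j<m. w j * x j)}"
proof -
  define z where "z x = (\<Sum>j<m. w j * x j)" for x :: vec
  have [measurable]: "z \<in> borel_measurable borel" unfolding z_def by measurable
  define S where "S s = {x::vec. x(m := s) \<in> K}" for s
  have [measurable]: "S s \<in> sets borel" for s unfolding S_def by measurable
  define G where "G s = measure (leb m) (S s)" for s
  define \<Phi> where "\<Phi> s \<tau> = measure (leb m) {x\<in>S s. \<tau> < z x}" for s \<tau>
  define \<eta> where "\<eta> = \<Phi> 0 0"
  have conv_S: "convex_set (S s)" "convex_set {x\<in>S s. \<tau> < z x}" for s \<tau>
    unfolding S_def z_def using conv by (intro convex_set_slice convex_set_half_space; assumption)+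
  have bd_S: "\<bar>x i\<bar> \<le> R" if "x \<in> S s" "i < m" for x i s
    using that bd[of "x(m := s)" i] by (simp add: S_def)
  have eS: "emeasure (leb m) A = ennreal (measure (leb m) A)" if "A \<subseteq> S s" for A s
  proof -
    have "emeasure (leb m) A < \<infinity>"
      using that bd_S by (intro emeasure_leb_bounded[of A m R]) blast
    then show ?thesis by (intro emeasure_eq_ennreal_measure) auto
  qed
  have comb: "(\<lambda>i. \<alpha> * x i + \<beta> * y i) \<in> S (\<alpha> * s + \<beta> * t)"
    if "x \<in> S s" "y \<in> S t" "\<alpha> > 0" "\<beta> > 0" "\<alpha> + \<beta> = 1" for x y s t \<alpha> \<beta>
    using convex_setD[OF conv, of "x(m := s)" "y(m := t)" \<alpha> \<beta>] that
    unfolding slice_combination by (simp add: S_def)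
  have bm_G: "G s powr \<alpha> * G t powr \<beta> \<le> G (\<alpha> * s + \<beta> * t)"
    if "\<alpha> > 0" "\<beta> > 0" "\<alpha> + \<beta> = 1" for s t \<alpha> \<beta>
  proof -
    have "ennreal (G s powr \<alpha> * G t powr \<beta>) \<le> emeasure (leb m) (S (\<alpha> * s + \<beta> * t))"
      unfolding G_def
      by (rule brunn_minkowski_multiplicative[of _ _ _ _ R]) (use that conv_S bd_S comb in auto)
    also have "\<dots> = ennreal (G (\<alpha> * s + \<beta> * t))" unfolding G_def by (rule eS[OF order_refl])
    finally show ?thesis by (simp add: G_def)
  qed
  have bm_\<Phi>: "\<Phi> s \<sigma> powr \<alpha> * \<Phi> t \<tau> powr \<beta> \<le> \<Phi> (\<alpha> * s + \<beta> * t) (\<alpha> * \<sigma> + \<beta> * \<tau>)"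
    if ab: "\<alpha> > 0" "\<beta> > 0" "\<alpha> + \<beta> = 1" for s t \<sigma> \<tau> \<alpha> \<beta>
  proof -
    have "ennreal (\<Phi> s \<sigma> powr \<alpha> * \<Phi> t \<tau> powr \<beta>)
        \<le> emeasure (leb m) {x\<in>S (\<alpha> * s + \<beta> * t). \<alpha> * \<sigma> + \<beta> * \<tau> < z x}"
      unfolding \<Phi>_def
    proof (rule brunn_minkowski_multiplicative[of _ _ _ _ R])
      show "{x\<in>S s. \<sigma> < z x} \<in> sets borel" "{x\<in>S t. \<tau> < z x} \<in> sets borel"
          "{x\<in>S (\<alpha> * s + \<beta> * t). \<alpha> * \<sigma> + \<beta> * \<tau> < z x} \<in> sets borel"
        by measurable
      fix x y assume xy: "x \<in> {x\<in>S s. \<sigma> < z x}" "y \<in> {x\<in>S t. \<tau> < z x}"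
      have "\<alpha> * \<sigma> + \<beta> * \<tau> < \<alpha> * z x + \<beta> * z y"
        using xy ab by (intro add_strict_mono mult_strict_left_mono) auto
      then have "\<alpha> * \<sigma> + \<beta> * \<tau> < z (\<lambda>i. \<alpha> * x i + \<beta> * y i)"
        by (simp add: z_def linear_form_combination)
      then show "(\<lambda>i. \<alpha> * x i + \<beta> * y i) \<in> {x\<in>S (\<alpha> * s + \<beta> * t). \<alpha> * \<sigma> + \<beta> * \<tau> < z x}"
        using comb[of x s y t] xy ab by simp
    qed (use conv_S bd_S ab in auto)
    also have "\<dots> = ennreal (\<Phi> (\<alpha> * s + \<beta> * t) (\<alpha> * \<sigma> + \<beta> * \<tau>))"
      unfolding \<Phi>_def by (rule eS) blast
    finally show ?thesis by (simp add: \<Phi>_def)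
  qed
  have target: "\<eta> \<le> measure (leb m) {x. x(m := 0) \<in> K \<and> 0 \<le> (\<Sum>j<m. w j * x j)}"
  proof -
    have *: "{x. x(m := 0) \<in> K \<and> 0 \<le> (\<Sum>j<m. w j * x j)} = {x\<in>S 0. 0 \<le> z x}"
      by (simp add: S_def z_def)
    have "ennreal \<eta> \<le> emeasure (leb m) {x\<in>S 0. 0 \<le> z x}"
      unfolding \<eta>_def \<Phi>_def by (subst eS[symmetric, of _ 0]) (auto intro!: emeasure_mono, measurable)
    also have "\<dots> = ennreal (measure (leb m) {x\<in>S 0. 0 \<le> z x})"
      by (rule eS) blast
    finally show ?thesis unfolding * by simp
  qed
  have \<eta>0: "\<eta> \<ge> 0" by (simp add: \<eta>_def \<Phi>_def)
  have "G 0 / 64 \<le> measure (leb m) {x. x(m := 0) \<in> K \<and> 0 \<le> (\<Sum>j<m. w j * x j)}"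
  proof (cases "(\<forall>j<m. w j = 0) \<or> G 0 = 0")
    case True
    then show ?thesis by (auto simp: G_def S_def)
  next
    case False
    then obtain k where k: "k < m" "w k \<noteq> 0" by auto
    have G0: "G 0 > 0" using False by (simp add: G_def zero_less_measure_iff)
    define E where "E = {(s, \<tau>). \<eta> < \<Phi> s \<tau>}"
    have "convex E"
    proof (rule convexI)
      fix p q u v assume pq: "p \<in> E" "q \<in> E" and uv: "0 \<le> (u::real)" "0 \<le> v" "u + v = 1"
      obtain s \<sigma> t \<tau> where st: "p = (s, \<sigma>)" "q = (t, \<tau>)" by (cases p; cases q)
      show "u *\<^sub>R p + v *\<^sub>R q \<in> E"
      proof (cases "u = 0 \<or> v = 0")
        case True
        then show ?thesis using pq uv by auto
      next
        case False
        have "\<eta> < min (\<Phi> s \<sigma>) (\<Phi> t \<tau>)" using pq by (simp add: E_def st)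
        also have "\<dots> \<le> \<Phi> s \<sigma> powr u * \<Phi> t \<tau> powr v"
          using False uv by (intro min_le_powr_mult) (auto simp: \<Phi>_def)
        also have "\<dots> \<le> \<Phi> (u * s + v * t) (u * \<sigma> + v * \<tau>)"
          using False uv by (intro bm_\<Phi>) auto
        finally show ?thesis by (simp add: E_def st)
      qed
    qed
    moreover have "0 \<notin> E" by (simp add: E_def \<eta>_def zero_prod_def)
    ultimately obtain a where a: "a \<noteq> 0" "\<And>p. p \<in> E \<Longrightarrow> 0 \<le> inner a p"
      using separating_hyperplane_set_0[of E] by blast
    define \<alpha> \<beta> where "\<alpha> = - fst a" "\<beta> = - snd a"
    have ab: "\<alpha> \<noteq> 0 \<or> \<beta> \<noteq> 0" using a(1) by (auto simp: \<alpha>_\<beta>_def zero_prod_def prod_eq_iff)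
    have outside: "\<Phi> s \<tau> \<le> \<eta>" if "\<alpha> * s + \<beta> * \<tau> > 0" for s \<tau>
    proof (rule ccontr)
      assume "\<not> \<Phi> s \<tau> \<le> \<eta>"
      then have "(s, \<tau>) \<in> E" by (simp add: E_def)
      from a(2)[OF this] show False using that by (simp add: \<alpha>_\<beta>_def inner_prod_def)
    qed
    \<comment> \<open>A slice \<open>{\<alpha> s + \<beta> z x > 0}\<close> is exhausted by sets \<open>{z x > c k}\<close> with \<open>(s, c k)\<close> strictly
      inside the half plane. For \<open>\<beta> < 0\<close>, and for \<open>\<beta> = 0 < \<alpha> s\<close>, the sequence \<open>c\<close> can be taken to tend to
      \<open>-\<infinity>\<close>, so that even the whole slice of \<open>K\<close> has volume at most \<open>\<eta>\<close>.\<close>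
    have limit: "emeasure (leb m) A \<le> ennreal \<eta>"
      if c: "decseq c" "\<And>k. \<Phi> s (c k) \<le> \<eta>" and A: "\<And>x. x \<in> A \<Longrightarrow> x \<in> S s \<and> (\<exists>k. c k < z x)"
      for A s and c :: "nat \<Rightarrow> real"
    proof -
      have "emeasure (leb m) A \<le> emeasure (leb m) (\<Union>k. {x\<in>S s. c k < z x})"
        using A by (intro emeasure_mono) (auto, measurable)
      also have "\<dots> = (SUP k. emeasure (leb m) {x\<in>S s. c k < z x})"
      proof (rule SUP_emeasure_incseq[symmetric])
        show "incseq (\<lambda>k. {x\<in>S s. c k < z x})"
          using c(1) by (auto simp: incseq_def decseq_def intro: le_less_trans)
      qed auto
      also have "\<dots> \<le> ennreal \<eta>"
        using c(2) by (intro SUP_least) (subst eS[of _ s], auto simp: \<Phi>_def intro: ennreal_leI)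
      finally show ?thesis .
    qed
    have slice: "emeasure (leb m) {x\<in>S s. 0 < \<alpha> * s + \<beta> * z x} \<le> ennreal \<eta>" for s
    proof -
      consider "\<beta> > 0" | "\<beta> < 0 \<or> \<beta> = 0 \<and> \<alpha> * s > 0" | "\<beta> = 0" "\<alpha> * s \<le> 0" by linarith
      then show ?thesis
      proof cases
        case 1
        define c where "c k = - \<alpha> * s / \<beta> + inverse (real (Suc k))" for k
        show ?thesis
        proof (rule limit)
          show "decseq c" unfolding c_def decseq_def by (auto intro!: le_imp_inverse_le)
          have "\<alpha> * s + \<beta> * c k = \<beta> * inverse (real (Suc k))" for k
            using 1 by (simp add: c_def distrib_left right_diff_distrib)
          then show "\<Phi> s (c k) \<le> \<eta>" for k using 1 by (intro outside) simp
          fix x assume x: "x \<in> {x\<in>S s. 0 < \<alpha> * s + \<beta> * z x}"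
          then have "- \<alpha> * s / \<beta> < z x" using 1 by (simp add: field_simps)
          then obtain k where "inverse (real (Suc k)) < z x - (- \<alpha> * s / \<beta>)"
            using reals_Archimedean[of "z x - (- \<alpha> * s / \<beta>)"] by auto
          then have "c k < z x" by (simp add: c_def)
          then show "x \<in> S s \<and> (\<exists>k. c k < z x)" using x by auto
        qed
      next
        case 2
        have "\<exists>N::nat. \<alpha> * s > \<beta> * real N"
        proof (cases "\<beta> < 0")
          case True
          obtain N :: nat where "real N > \<alpha> * s / \<beta>" using reals_Archimedean2 by blast
          then show ?thesis using True by (intro exI[of _ N]) (simp add: field_simps)
        qed (use 2 in auto)
        then obtain N :: nat where N: "\<alpha> * s > \<beta> * real N" by blast
        show ?thesis
        proof (rule limit[where c = "\<lambda>k. - real (N + k)"])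
          show "decseq (\<lambda>k. - real (N + k))" by (auto simp: decseq_def)
          have "\<beta> * real (N + k) \<le> \<beta> * real N" for k
            using 2 by (auto simp: mult_le_cancel_left)
          then show "\<Phi> s (- real (N + k)) \<le> \<eta>" for k
            using N by (intro outside) (smt (verit) mult_minus_right)
          fix x assume x: "x \<in> {x\<in>S s. 0 < \<alpha> * s + \<beta> * z x}"
          obtain k :: nat where "real k > - z x" using reals_Archimedean2 by blast
          then have "- real (N + k) < z x" by simp
          then show "x \<in> S s \<and> (\<exists>k. - real (N + k) < z x)" using x by blast
        qed
      next
        case 3
        then show ?thesis by simp
      qed
    qed
    define v where "v i = (if i < m then \<beta> * w i else \<alpha>)" for i
    have v: "(\<Sum>i<Suc m. v i * x i) = \<alpha> * x m + \<beta> * z x" for x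
      by (simp add: v_def z_def sum_distrib_left mult.assoc)
    obtain k' where k': "k' < Suc m" "v k' \<noteq> 0"
    proof (cases "\<beta> = 0")
      case True
      then show ?thesis using ab that[of m] by (simp add: v_def)
    next
      case False
      then show ?thesis using k that[of k] by (simp add: v_def)
    qed
    define M where "M = measure (leb (Suc m)) K"
    have M: "M > 0" using pos by (simp add: M_def)
    have eK: "emeasure (leb (Suc m)) A = ennreal (measure (leb (Suc m)) A)" if "A \<subseteq> K" for A
    proof -
      have "emeasure (leb (Suc m)) A < \<infinity>"
        using that bd by (intro emeasure_leb_bounded[of A "Suc m" R]) blast
      then show ?thesis by (intro emeasure_eq_ennreal_measure) auto
    qed
    \<comment> \<open>The slices at height \<open>s\<close> are at most \<open>min \<eta> (G s) \<le> sqrt (\<eta> * G s) \<le> q * G (s/2)\<close>.\<close>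
    define q where "q = sqrt (\<eta> / G 0)"
    have q: "q \<ge> 0" "q\<^sup>2 = \<eta> / G 0" using \<eta>0 G0 by (auto simp: q_def)
    have [measurable]: "G \<in> borel_measurable borel"
      unfolding G_def S_def measure_def by measurable
    have intG: "(\<integral>\<^sup>+s. ennreal (G s) \<partial>lborel) = ennreal M"
    proof -
      have "(\<integral>\<^sup>+s. ennreal (G s) \<partial>lborel) = (\<integral>\<^sup>+s. emeasure (leb m) (S s) \<partial>lborel)"
        unfolding G_def by (intro nn_integral_cong eS[symmetric]) auto
      also have "\<dots> = emeasure (leb (Suc m)) K" by (simp add: emeasure_leb_Suc S_def)
      finally show ?thesis by (simp add: eK M_def)
    qed
    have "ennreal (M / 4) \<le> ennreal (measure (leb (Suc m)) {x\<in>K. 0 < (\<Sum>i<Suc m. v i * x i)})"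
      unfolding M_def by (intro ennreal_leI half_space_through_centroid[where K = K and n = "Suc m" and R = R and w = v and k = k'] conv bd centered k') auto
    also have "\<dots> = emeasure (leb (Suc m)) {x\<in>K. 0 < \<alpha> * x m + \<beta> * z x}"
      unfolding v by (rule eK[symmetric]) auto
    also have "\<dots> = (\<integral>\<^sup>+s. emeasure (leb m) {x. x(m := s) \<in> {x\<in>K. 0 < \<alpha> * x m + \<beta> * z x}} \<partial>lborel)"
      by (rule emeasure_leb_Suc) measurable
    also have "\<dots> \<le> (\<integral>\<^sup>+s. ennreal q * ennreal (G (0 + 1 / 2 * s)) \<partial>lborel)"
    proof (rule nn_integral_mono)
      fix s
      have "z (x(m := s)) = z x" for x unfolding z_def by (intro sum.cong) auto
      then have set: "{x. x(m := s) \<in> {x\<in>K. 0 < \<alpha> * x m + \<beta> * z x}} = {x\<in>S s. 0 < \<alpha> * s + \<beta> * z x}"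
        by (simp add: S_def)
      define r where "r = measure (leb m) {x\<in>S s. 0 < \<alpha> * s + \<beta> * z x}"
      have er: "emeasure (leb m) {x\<in>S s. 0 < \<alpha> * s + \<beta> * z x} = ennreal r"
        unfolding r_def by (rule eS) blast
      have r1: "r \<le> \<eta>" using slice[of s] \<eta>0 by (simp add: er)
      have r2: "r \<le> G s"
      proof -
        have "ennreal r \<le> emeasure (leb m) (S s)"
          unfolding er[symmetric] by (intro emeasure_mono) auto
        then show ?thesis by (simp add: eS[OF order_refl] G_def)
      qed
      have r0: "r \<ge> 0" by (simp add: r_def)
      \<comment> \<open>Log-concavity at the midpoint of the central slice and the given one.\<close>
      have mid: "G 0 * G s \<le> (G (1 / 2 * s))\<^sup>2"
      proof -
        have "sqrt (G 0) * sqrt (G s) \<le> G (1 / 2 * s)"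
          using bm_G[of "1/2" "1/2" 0 s] by (simp add: powr_half_sqrt G_def)
        then have "(sqrt (G 0) * sqrt (G s))\<^sup>2 \<le> (G (1 / 2 * s))\<^sup>2"
          by (intro power_mono) (auto simp: G_def)
        then show ?thesis by (simp add: power_mult_distrib G_def)
      qed
      have "r\<^sup>2 \<le> \<eta> * G s"
        using r0 r1 r2 \<eta>0 by (auto simp: power2_eq_square intro: mult_mono)
      also have "\<dots> \<le> \<eta> * ((G (1 / 2 * s))\<^sup>2 / G 0)"
        using mid G0 \<eta>0 by (intro mult_left_mono) (auto simp: field_simps)
      also have "\<dots> = (q * G (1 / 2 * s))\<^sup>2" by (simp add: power_mult_distrib q)
      finally have "r \<le> q * G (1 / 2 * s)"
        by (rule power2_le_imp_le) (simp add: q G_def)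
      then show "emeasure (leb m) {x. x(m := s) \<in> {x\<in>K. 0 < \<alpha> * x m + \<beta> * z x}}
          \<le> ennreal q * ennreal (G (0 + 1 / 2 * s))"
        unfolding set er using q(1) by (simp add: G_def ennreal_leI flip: ennreal_mult)
    qed
    also have "\<dots> = ennreal q * (\<integral>\<^sup>+s. ennreal (G (0 + 1 / 2 * s)) \<partial>lborel)"
      by (subst nn_integral_cmult) auto
    also have "(\<integral>\<^sup>+s. ennreal (G (0 + 1 / 2 * s)) \<partial>lborel) = ennreal (2 * M)"
    proof -
      let ?X = "\<integral>\<^sup>+s. ennreal (G (0 + 1 / 2 * s)) \<partial>lborel"
      have "ennreal M = ennreal (1 / 2) * ?X"
        using nn_integral_real_affine[of "\<lambda>s. ennreal (G s)" "1/2" 0] by (simp add: intG)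
      then have "ennreal 2 * ennreal M = (ennreal 2 * ennreal (1 / 2)) * ?X"
        by (simp add: mult.assoc)
      also have "ennreal 2 * ennreal (1 / 2) = 1"
        by (subst ennreal_mult[symmetric]) auto
      finally show ?thesis using M by (simp add: ennreal_mult)
    qed
    also have "ennreal q * ennreal (2 * M) = ennreal (q * (2 * M))"
      using q M by (simp add: ennreal_mult)
    finally have "M / 4 \<le> q * (2 * M)" using q M by simp
    then have "1 / 8 \<le> q" using M by (simp add: field_simps)
    then have "(1 / 8)\<^sup>2 \<le> q\<^sup>2" by (intro power_mono) auto
    then have "G 0 / 64 \<le> \<eta>" using G0 by (simp add: q power_divide field_simps)
    then show ?thesis using target by simp
  qed
  then show ?thesis by (simp add: G_def S_def)
qed

section \<open>Coordinates on a hyperplane and the bipolar theorem\<close>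

text \<open>
  The reflection that exchanges the last standard unit vector \<open>\<epsilon>\<^sub>m\<close> with \<open>u\<close> maps \<open>\<epsilon>\<^sub>0, ..., \<epsilon>\<^bsub>m-1\<^esub>\<close> to an
  orthonormal basis of \<open>u\<^sup>\<bottom>\<close>. It sends \<open>\<epsilon>\<^sub>j\<close> to \<open>\<epsilon>\<^sub>j - u\<^sub>j (u - \<epsilon>\<^sub>m) / (1 - u\<^sub>m)\<close>.
\<close>

lemma orthonormal_basis_of_hyperplane_exists:
  assumes u: "u \<in> unit_sphere (Suc m)"
  shows "\<exists>e. orthonormal_basis_of_hyperplane (Suc m) u e"
proof -
  \<comment> \<open>For \<open>u = \<epsilon>\<^sub>m\<close> this is \<open>1 / 0 = 0\<close>, but then \<open>u j = 0\<close> for \<open>j < m\<close>, and \<open>e j\<close> is the unit vector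
    \<open>\<epsilon>\<^sub>j\<close>, as it should be.\<close>
  define c where "c = 1 / (1 - u m)"
  define \<delta> where "\<delta> j i = (if i = j then 1 else (0::real))" for j i :: nat
  define e where "e j = (\<lambda>i. \<delta> j i - c * u j * (u i - \<delta> m i))" for j
  have uR: "u i = 0" if "i \<ge> Suc m" for i
    using u that by (simp add: unit_sphere_def topspace_Euclidean_space)
  have norm: "(\<Sum>i<m. u i * u i) + u m * u m = 1"
    using unit_sphere_dot[OF u] by (simp add: dot_def)
  have c: "c * c * u j * (2 - 2 * u m) = 2 * c * u j" if "j < m" for j
  proof (cases "u m = 1")
    case True
    then have "(\<Sum>i<m. u i * u i) = 0" using norm by simp
    then have "u j = 0" using that by (auto simp: sum_nonneg_eq_0_iff)
    then show ?thesis by simp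
  next
    case False
    then have "c * (1 - u m) = 1" by (simp add: c_def)
    moreover have "c * c * u j * (2 - 2 * u m) = 2 * c * u j * (c * (1 - u m))" by (simp add: algebra_simps)
    ultimately show ?thesis by simp
  qed
  have c1: "u j = c * u j * (1 - u m)" if "j < m" for j
  proof (cases "u m = 1")
    case True
    then have "(\<Sum>i<m. u i * u i) = 0" using norm by simp
    then have "u j = 0" using that by (auto simp: sum_nonneg_eq_0_iff)
    then show ?thesis by simp
  qed (simp add: c_def)
  have sum_\<delta>: "(\<Sum>i<m. \<delta> j i * f i) = f j" if "j < m" for j and f :: "nat \<Rightarrow> real"
    using that by (simp add: \<delta>_def if_distrib[of "\<lambda>x. x * _"] cong: if_cong)
  have e_lt: "e j i = \<delta> j i - c * u j * u i" if "i < m" for i j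
    using that by (simp add: e_def \<delta>_def)
  have e_m: "e j m = c * u j * (1 - u m)" if "j < m" for j
    using that by (simp add: e_def \<delta>_def algebra_simps)
  have dot_u: "dot (Suc m) u (e j) = 0" if j: "j < m" for j
  proof -
    have "dot (Suc m) u (e j) = (\<Sum>i<m. \<delta> j i * u i - c * u j * (u i * u i)) + u m * (c * u j * (1 - u m))"
      using j by (simp add: dot_def e_lt e_m algebra_simps)
    also have "\<dots> = u j - c * u j * (\<Sum>i<m. u i * u i) + u m * (c * u j * (1 - u m))"
      using j by (simp add: sum_subtractf sum_\<delta> flip: sum_distrib_left)
    also have "\<dots> = u j - c * u j * (1 - u m)"
      using norm by (simp add: eq_diff_eq[symmetric]) (simp add: algebra_simps)
    finally show ?thesis using c1[OF j] by simp
  qed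
  have dot_e: "dot (Suc m) (e j) (e k) = \<delta> j k" if j: "j < m" and k: "k < m" for j k
  proof -
    have "dot (Suc m) (e j) (e k) = (\<Sum>i<m. \<delta> j i * \<delta> k i - c * u k * (\<delta> j i * u i) - c * u j * (\<delta> k i * u i)
        + c * u j * (c * u k) * (u i * u i)) + c * u j * (1 - u m) * (c * u k * (1 - u m))"
      using j k by (simp add: dot_def e_lt e_m algebra_simps)
    also have "\<dots> = \<delta> k j - c * u k * u j - c * u j * u k
        + c * u j * (c * u k) * (\<Sum>i<m. u i * u i) + c * u j * (1 - u m) * (c * u k * (1 - u m))"
      using j k by (simp add: sum_subtractf sum.distrib sum_\<delta> flip: sum_distrib_left)
    also have "\<dots> = \<delta> k j - 2 * c * u j * u k + c * c * u j * (2 - 2 * u m) * u k"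
      using norm by (simp add: eq_diff_eq[symmetric]) (simp add: algebra_simps)
    also have "\<dots> = \<delta> k j" using c[OF j] by simp
    finally show ?thesis by (simp add: \<delta>_def)
  qed
  have "e j \<in> hyperplane (Suc m) u" if "j < m" for j
    using that dot_u[OF that] uR by (auto simp: hyperplane_def topspace_Euclidean_space e_def \<delta>_def)
  then have "orthonormal_basis_of_hyperplane (Suc m) u e"
    using dot_e by (auto simp: orthonormal_basis_of_hyperplane_def \<delta>_def)
  then show ?thesis by blast
qed

text \<open>
  The basis that the definition of the measure on \<open>u\<^sup>\<bottom>\<close> selects, completed to a frame of \<open>\<real>\<^sup>n\<close> by \<open>u\<close> itself.
\<close>

lemma hyperplane_leb_frame:
  assumes u: "u \<in> unit_sphere (Suc m)"
  obtains e where "orthonormal_frame (Suc m) (e(m := u))"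
    "hyperplane_leb (Suc m) u = distr (leb m) borel (lincomb m e)"
proof
  define e where "e = (SOME e. orthonormal_basis_of_hyperplane (Suc m) u e)"
  have e: "orthonormal_basis_of_hyperplane (Suc m) u e"
    unfolding e_def using orthonormal_basis_of_hyperplane_exists[OF u] by (rule someI_ex)
  show "hyperplane_leb (Suc m) u = distr (leb m) borel (lincomb m e)"
    by (simp add: hyperplane_leb_def e_def lincomb_def[abs_def])
  have "u \<in> Rn (Suc m)" "dot (Suc m) u u = 1"
    using u unit_sphere_dot[OF u] by (auto simp: unit_sphere_def)
  then show "orthonormal_frame (Suc m) (e(m := u))"
    using e unfolding orthonormal_frame_def orthonormal_basis_of_hyperplane_def hyperplane_def
    by (auto simp: less_Suc_eq dot_commute)
qed

lemma lincomb_Suc_upd: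
  "lincomb (Suc m) (e(m := u)) (x(m := s)) = (\<lambda>i. lincomb m e x i + s * u i)"
  by (rule ext) (simp add: lincomb_def)

lemma lincomb_in_hyperplane:
  assumes "orthonormal_frame (Suc m) (e(m := u))"
  shows "lincomb m e x \<in> hyperplane (Suc m) u"
proof -
  have eq: "lincomb m e x = lincomb (Suc m) (e(m := u)) (x(m := 0))"
    by (simp add: lincomb_Suc_upd)
  show ?thesis
    using dot_lincomb_frame[OF assms, of m "x(m := 0)"] lincomb_in_Rn[OF assms, of "x(m := 0)"]
    unfolding eq hyperplane_def by (simp add: dot_commute)
qed

lemma hyperplane_coordinates:
  assumes b: "orthonormal_frame (Suc m) (e(m := u))" and z: "z \<in> hyperplane (Suc m) u"
  shows "lincomb m e (\<lambda>j. dot (Suc m) z (e j)) = z"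
proof -
  have "z \<in> Rn (Suc m)" "dot (Suc m) z u = 0"
    using z by (auto simp: hyperplane_def dot_commute)
  then show ?thesis
    using orthonormal_frame_expansion[OF b, of z] by (simp add: lincomb_def)
qed

lemma continuous_on_dot [continuous_intros]:
  assumes "continuous_on A f" "continuous_on A g"
  shows "continuous_on A (\<lambda>x. dot n (f x) (g x))"
  unfolding dot_def
  by (intro continuous_on_sum continuous_on_mult
      continuous_on_product_then_coordinatewise[OF assms(1)] continuous_on_product_then_coordinatewise[OF assms(2)])

lemma continuous_on_vdiff [continuous_intros]:
  assumes "continuous_on A f" "continuous_on A g"
  shows "continuous_on A (\<lambda>x. vdiff (f x) (g x))"
  unfolding vdiff_def
  by (intro continuous_on_coordinatewise_then_product continuous_on_diff
      continuous_on_product_then_coordinatewise[OF assms(1)] continuous_on_product_then_coordinatewise[OF assms(2)])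

lemma closed_Rn: "closed (Rn n)"
proof -
  have "Rn n = (\<Inter>i\<in>{n..}. {x. x i = 0})" by (auto simp: topspace_Euclidean_space)
  moreover have "closed {x::vec. x i = 0}" for i
    by (intro closed_Collect_eq continuous_on_const continuous_on_product_coordinates)
  ultimately show ?thesis by auto
qed

lemma closed_hyperplane: "closed (hyperplane n u)"
proof -
  have "hyperplane n u = Rn n \<inter> {x. dot n u x = 0}" by (auto simp: hyperplane_def)
  then show ?thesis
    by (auto intro!: closed_Int closed_Rn closed_Collect_eq continuous_intros)
qed

lemma closed_hyperplane_polar: "closed (hyperplane_polar n u z C)"
proof -
  have "hyperplane_polar n u z C =
      hyperplane n u \<inter> (\<Inter>x\<in>C. {y. dot n (vdiff y z) (vdiff x z) \<le> 1})"
    by (auto simp: hyperplane_polar_def)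
  moreover have "closed {y. dot n (vdiff y z) (vdiff x z) \<le> 1}" for x
    by (intro closed_Collect_le continuous_on_dot continuous_on_vdiff continuous_on_id continuous_on_const)
  ultimately show ?thesis
    by (simp add: closed_Int closed_INT closed_hyperplane)
qed

lemma dot_vdiff_left: "dot n (vdiff x y) w = dot n x w - dot n y w"
  by (simp add: dot_def vdiff_def left_diff_distrib sum_subtractf)

lemma dot_vdiff_right: "dot n w (vdiff x y) = dot n w x - dot n w y"
  by (simp add: dot_def vdiff_def right_diff_distrib sum_subtractf)

lemma dot_self_eq_0:
  assumes "dot n x x = 0" "x \<in> Rn n"
  shows "x = (\<lambda>_. 0)"
proof
  fix i
  have "\<forall>i<n. x i = 0" using assms(1) by (auto simp: dot_def sum_nonneg_eq_0_iff)
  then show "x i = 0"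
    using assms(2) by (cases "i < n") (auto simp: topspace_Euclidean_space)
qed

text \<open>
  The point \<open>k0\<close> is the point of \<open>K\<close> nearest to \<open>y\<close>, and \<open>v = y - k0\<close>. Moving from \<open>k0\<close> a little towards another point \<open>k\<close>
  of \<open>K\<close> does not decrease the distance from \<open>y\<close>, hence \<open>\<langle>v, k - k0\<rangle> \<le> 0\<close>.
\<close>

lemma separation_compact_convex:
  assumes K: "compact K" "convex_set K" "K \<noteq> {}" "K \<subseteq> Rn n" and y: "y \<in> Rn n" "y \<notin> K"
  obtains v k0 where "v \<in> Rn n" "k0 \<in> K" "\<And>k. k \<in> K \<Longrightarrow> dot n v k \<le> dot n v k0" "dot n v k0 < dot n v y"
proof -
  have "continuous_on K (\<lambda>k. dot n (vdiff y k) (vdiff y k))"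
    by (intro continuous_intros)
  then obtain k0 where k0: "k0 \<in> K"
      "\<And>k. k \<in> K \<Longrightarrow> dot n (vdiff y k0) (vdiff y k0) \<le> dot n (vdiff y k) (vdiff y k)"
    using continuous_attains_inf[OF K(1,3)] by blast
  define v where "v = vdiff y k0"
  have v: "v \<in> Rn n" using y(1) k0(1) K(4) by (auto simp: v_def vdiff_def topspace_Euclidean_space)
  have "dot n v v \<noteq> 0"
  proof
    assume "dot n v v = 0"
    then have "v = (\<lambda>_. 0)" using v by (rule dot_self_eq_0)
    then have "y = k0" by (simp add: v_def vdiff_def fun_eq_iff)
    then show False using y(2) k0(1) by simp
  qed
  moreover have "dot n v v \<ge> 0" by (simp add: dot_def sum_nonneg)
  ultimately have vv: "dot n v v > 0" by simp
  show ?thesis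
  proof
    show "dot n v k0 < dot n v y"
      using vv unfolding v_def by (simp add: dot_vdiff_right)
    fix k assume k: "k \<in> K"
    define d where "d = vdiff k k0"
    define N where "N = dot n d d"
    have N: "N \<ge> 0" by (simp add: N_def dot_def sum_nonneg)
    have ineq: "2 * dot n v d \<le> t * N" if t: "0 < t" "t \<le> 1" for t
    proof -
      define p where "p = (\<lambda>i. (1 - t) * k0 i + t * k i)"
      have "p \<in> K" unfolding p_def using convex_setD[OF K(2) k0(1) k, of "1 - t" t] t by simp
      then have "dot n v v \<le> dot n (vdiff y p) (vdiff y p)" using k0(2) by (simp add: v_def)
      also have "vdiff y p = vdiff v (smul t d)"
        by (simp add: vdiff_def p_def v_def d_def smul_def algebra_simps)
      also have "dot n (vdiff v (smul t d)) (vdiff v (smul t d)) = dot n v v - 2 * t * dot n v d + t * t * N"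
        by (simp add: dot_vdiff_left dot_vdiff_right dot_smul_left dot_smul_right N_def dot_commute[of n d v] algebra_simps)
      finally have "t * (2 * dot n v d) \<le> t * (t * N)" by (simp add: algebra_simps)
      then show ?thesis using t by simp
    qed
    have "dot n v d \<le> 0"
    proof (rule ccontr)
      assume "\<not> dot n v d \<le> 0"
      then have D: "dot n v d > 0" by simp
      then have "N > 0" using ineq[of 1] N by auto
      define t where "t = min 1 (dot n v d / N)"
      have "t * N \<le> dot n v d / N * N" using N by (intro mult_right_mono) (auto simp: t_def)
      also have "\<dots> = dot n v d" using \<open>N > 0\<close> by simp
      finally show False using ineq[of t] D \<open>N > 0\<close> by (simp add: t_def)
    qed
    then show "dot n v k \<le> dot n v k0" by (simp add: d_def dot_vdiff_right)
  qed (use v k0 in auto)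
qed

text \<open>
  Were \<open>y\<close> outside \<open>K\<close>, a separating linear form, scaled by a value \<open>d\<close> strictly between its maximum on \<open>K\<close> and its
  value at \<open>y\<close>, would be an element of the polar body that exceeds \<open>1\<close> at \<open>y\<close>. Since \<open>0 \<in> K\<close>, the maximum is
  nonnegative and \<open>d\<close> is positive.
\<close>

lemma bipolar:
  assumes K: "compact K" "convex_set K" "K \<subseteq> Rn n" "(\<lambda>_. 0) \<in> K"
    and y: "y \<in> Rn n" "\<And>x. x \<in> polar n K \<Longrightarrow> dot n y x \<le> 1"
  shows "y \<in> K"
proof (rule ccontr)
  assume "y \<notin> K"
  then obtain v k0 where v: "v \<in> Rn n" "k0 \<in> K" "\<And>k. k \<in> K \<Longrightarrow> dot n v k \<le> dot n v k0" "dot n v k0 < dot n v y"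
    using separation_compact_convex[OF K(1,2) _ K(3) y(1)] K(4) by blast
  have c: "0 \<le> dot n v k0" using v(3)[OF K(4)] by (simp add: dot_def)
  define d where "d = (dot n v k0 + dot n v y) / 2"
  have d: "d > 0" "dot n v k0 \<le> d" "d < dot n v y" using c v(4) by (auto simp: d_def)
  have "smul (1 / d) v \<in> polar n K"
    unfolding polar_def
  proof (intro CollectI conjI ballI)
    show "smul (1 / d) v \<in> Rn n" using v(1) by (rule smul_in_Rn)
    fix k assume "k \<in> K"
    then have "dot n v k \<le> d" using v(3) d(2) by fastforce
    then show "dot n k (smul (1 / d) v) \<le> 1"
      using d(1) by (simp add: dot_smul_right dot_commute[of n k v])
  qed
  then have "dot n y (smul (1 / d) v) \<le> 1" by (rule y(2))
  then show False using d by (simp add: dot_smul_right dot_commute[of n y v])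
qed

section \<open>Comparison of the two radial functions\<close>

lemma convex_body_compact:
  assumes "convex_body n K"
  shows "compact K" "K \<subseteq> Rn n" "K \<in> sets borel" "convex_set K"
proof -
  have "compactin (Euclidean_space n) K" using assms by (simp add: convex_body_def)
  then have "compactin euclidean K"
    by (simp add: Euclidean_space_def compactin_subtopology euclidean_product_topology)
  then show "compact K" by simp
  then show "K \<in> sets borel" by (intro borel_closed compact_imp_closed)
  show "K \<subseteq> Rn n" "convex_set K"
    using assms by (auto simp: convex_body_def compactin_subspace)
qed

lemma compact_bounded_coordinates:
  assumes "compact (K :: vec set)"
  obtains R where "\<forall>x\<in>K. \<forall>i<n. \<bar>x i\<bar> \<le> R"
proof -
  have "continuous_on K (\<lambda>x. \<Sum>i<n. \<bar>x i\<bar>)"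
    by (intro continuous_on_sum continuous_on_rabs continuous_on_subset[OF continuous_on_product_coordinates]) auto
  then have "bounded ((\<lambda>x. \<Sum>i<n. \<bar>x i\<bar>) ` K)"
    using assms by (intro compact_imp_bounded compact_continuous_image)
  then obtain R where R: "\<And>x. x \<in> K \<Longrightarrow> \<bar>\<Sum>i<n. \<bar>x i\<bar>\<bar> \<le> R"
    by (auto simp: bounded_iff)
  have "\<bar>x i\<bar> \<le> R" if "x \<in> K" "i < n" for x i
    using that R[of x] member_le_sum[of i "{..<n}" "\<lambda>i. \<bar>x i\<bar>"] by auto
  then show ?thesis by (intro that) auto
qed

lemma set_integrable_coordinate:
  assumes [measurable]: "K \<in> sets borel" and bd: "\<forall>x\<in>K. \<forall>i<n. \<bar>x i\<bar> \<le> R" and "j < n"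
  shows "set_integrable (leb n) K (\<lambda>x. x j)"
  unfolding set_integrable_def
proof (rule integrableI_bounded)
  show "(\<lambda>x. indicator K x *\<^sub>R x j) \<in> borel_measurable (leb n)" by measurable
  have "(\<integral>\<^sup>+x. ennreal (norm (indicator K x *\<^sub>R x j)) \<partial>leb n) \<le> (\<integral>\<^sup>+x. ennreal R * indicator K x \<partial>leb n)"
    using bd \<open>j < n\<close> by (intro nn_integral_mono) (auto simp: indicator_def intro: ennreal_leI)
  also have "\<dots> = ennreal R * emeasure (leb n) K" by (simp add: nn_integral_cmult)
  also have "\<dots> < \<infinity>"
    using emeasure_leb_bounded[of K n R] bd by (simp add: ennreal_mult_less_top)
  finally show "(\<integral>\<^sup>+x. ennreal (norm (indicator K x *\<^sub>R x j)) \<partial>leb n) < \<infinity>" .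
qed

lemma integral_linear_form_eq_0:
  assumes K: "K \<in> sets borel" and bd: "\<forall>x\<in>K. \<forall>i<n. \<bar>x i\<bar> \<le> R"
    and centered: "\<And>j. j < n \<Longrightarrow> (LINT x:K|leb n. x j) = 0"
  shows "(LINT x:K|leb n. dot n v x) = 0"
proof -
  have "(LINT x:K|leb n. dot n v x) = (\<Sum>j<n. v j * (LINT x:K|leb n. x j))"
    using set_integrable_coordinate[OF K bd]
    unfolding set_lebesgue_integral_def set_integrable_def dot_def
    by (simp add: sum_distrib_left mult.left_commute[of _ "v _"])
  then show ?thesis using centered by simp
qed

lemma convex_body_measure_pos:
  assumes K: "convex_body n K"
  shows "measure (leb n) K > 0"
proof -
  obtain R where R: "\<forall>x\<in>K. \<forall>i<n. \<bar>x i\<bar> \<le> R"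
    using compact_bounded_coordinates[OF convex_body_compact(1)[OF K]] by blast
  have "emeasure (leb n) K > 0"
    using K convex_body_compact(3)[OF K] by (intro emeasure_leb_pos) (auto simp: convex_body_def)
  moreover have "emeasure (leb n) K < \<infinity>" using R by (intro emeasure_leb_bounded[of K n R]) auto
  ultimately show ?thesis by (simp add: measure_def enn2real_positive_iff)
qed

lemma centroid_0_imp_centered:
  assumes "convex_body n K" "centroid n K = (\<lambda>_. 0)"
  shows "(LINT x:K|leb n. x j) = 0"
proof -
  have "1 / measure (leb n) K * (LINT x:K|leb n. x j) = 0"
    using fun_cong[OF assms(2), of j] unfolding centroid_def .
  then show ?thesis using convex_body_measure_pos[OF assms(1)] by auto
qed

text \<open>
  A linear form that separates \<open>0\<close> from \<open>K\<close> is bounded away from \<open>0\<close> on \<open>K\<close>, so its integral over \<open>K\<close> could not vanish.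
\<close>

lemma centroid_in_convex_body:
  assumes K: "convex_body n K" and "centroid n K = (\<lambda>_. 0)"
  shows "(\<lambda>_. 0) \<in> K"
proof (rule ccontr)
  note c = convex_body_compact[OF K]
  note [measurable] = c(3)
  obtain R where R: "\<forall>x\<in>K. \<forall>i<n. \<bar>x i\<bar> \<le> R"
    using compact_bounded_coordinates[OF c(1)] by blast
  have M: "measure (leb n) K > 0" using K by (rule convex_body_measure_pos)
  then have "K \<noteq> {}" by auto
  have zero: "(\<lambda>_. 0) \<in> Rn n" by (simp add: topspace_Euclidean_space)
  assume "(\<lambda>_. 0) \<notin> K"
  then obtain v k0 where v: "\<And>k. k \<in> K \<Longrightarrow> dot n v k \<le> dot n v k0" "dot n v k0 < dot n v (\<lambda>_. 0)"
    using separation_compact_convex[OF c(1) c(4) \<open>K \<noteq> {}\<close> c(2) zero] by blast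
  have "(\<lambda>x. indicat_real K x *\<^sub>R dot n v x) = (\<lambda>x. \<Sum>i<n. v i * (indicat_real K x *\<^sub>R x i))"
    by (simp add: dot_def sum_distrib_left mult.left_commute)
  then have int: "set_integrable (leb n) K (\<lambda>x. dot n v x)"
    using set_integrable_coordinate[OF c(3) R]
    by (simp only: set_integrable_def) (intro Bochner_Integration.integrable_sum integrable_mult_right, simp)
  have fin: "emeasure (leb n) K < \<infinity>" using R by (intro emeasure_leb_bounded[of K n R]) auto
  have "(LINT x:K|leb n. dot n v x) \<le> (LINT x:K|leb n. dot n v k0)"
    using v(1) int fin
    by (intro set_integral_mono) (auto simp: set_integrable_def)
  also have "\<dots> = measure (leb n) K * dot n v k0"
    using fin by (simp add: set_lebesgue_integral_def)
  also have "\<dots> < 0"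
    using v(2) M by (intro mult_pos_neg) (simp_all add: dot_def)
  finally show False
    using integral_linear_form_eq_0[OF c(3) R centroid_0_imp_centered[OF K assms(2)], of v] by simp
qed

lemma emeasure_hyperplane_leb:
  assumes "hyperplane_leb (Suc m) u = distr (leb m) borel (lincomb m e)" "A \<in> sets borel"
  shows "emeasure (hyperplane_leb (Suc m) u) A = emeasure (leb m) {a. lincomb m e a \<in> A}"
  using assms by (simp add: emeasure_distr vimage_def)

text \<open>
  The preimage \<open>K'\<close> of \<open>K\<close> under the orthogonal map given by the frame has the same volume and again centroid \<open>0\<close>; its
  slice at height \<open>0\<close> of the last coordinate is \<open>K \<inter> u\<^sup>\<bottom>\<close> in the coordinates that define the measure on \<open>u\<^sup>\<bottom>\<close>.
\<close>

lemma half_section_of_centered_body: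
  assumes K: "convex_body (Suc m) K" and cent: "centroid (Suc m) K = (\<lambda>_. 0)"
    and u: "u \<in> unit_sphere (Suc m)"
  shows "measure (hyperplane_leb (Suc m) u) (K \<inter> hyperplane (Suc m) u) / 64
    \<le> measure (hyperplane_leb (Suc m) u) {y \<in> K \<inter> hyperplane (Suc m) u. 0 \<le> dot (Suc m) z y}"
proof -
  note c = convex_body_compact[OF K]
  note [measurable] = c(3)
  let ?n = "Suc m"
  obtain R where R: "\<forall>x\<in>K. \<forall>i<?n. \<bar>x i\<bar> \<le> R"
    using compact_bounded_coordinates[OF c(1)] by blast
  obtain e where b: "orthonormal_frame ?n (e(m := u))"
      and hl: "hyperplane_leb ?n u = distr (leb m) borel (lincomb m e)"
    using hyperplane_leb_frame[OF u] .
  let ?b = "e(m := u)" and ?T = "lincomb ?n (e(m := u))"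
  define K' where "K' = {x. ?T x \<in> K}"
  have K'[measurable]: "K' \<in> sets borel" unfolding K'_def by measurable
  have conv: "convex_set K'"
  proof (rule convex_setI)
    fix x y \<alpha> \<beta> assume xy: "x \<in> K'" "y \<in> K'" and ab: "0 \<le> (\<alpha>::real)" "0 \<le> \<beta>" "\<alpha> + \<beta> = 1"
    have "?T (\<lambda>i. \<alpha> * x i + \<beta> * y i) = (\<lambda>i. \<alpha> * ?T x i + \<beta> * ?T y i)"
      unfolding lincomb_def
      by (simp add: sum_distrib_left sum.distrib distrib_right distrib_left mult.assoc)
    then show "(\<lambda>i. \<alpha> * x i + \<beta> * y i) \<in> K'"
      using convex_setD[OF c(4) _ _ ab, of "?T x" "?T y"] xy by (simp add: K'_def)
  qed
  define R' where "R' = (\<Sum>j<?n. \<Sum>i<?n. R * \<bar>?b j i\<bar>)"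
  have bd: "\<bar>x j\<bar> \<le> R'" if x: "x \<in> K'" and j: "j < ?n" for x j
  proof -
    have R0: "R \<ge> 0" using x R[rule_format, of "?T x" 0] abs_ge_zero[of "?T x 0"] by (simp add: K'_def)
    have "\<bar>x j\<bar> = \<bar>dot ?n (?T x) (?b j)\<bar>" by (simp only: dot_lincomb_frame[OF b j])
    also have "\<dots> \<le> (\<Sum>i<?n. \<bar>?T x i * ?b j i\<bar>)" unfolding dot_def by (rule sum_abs)
    also have "\<dots> \<le> (\<Sum>i<?n. R * \<bar>?b j i\<bar>)"
      using x R[rule_format, of "?T x"]
      by (intro sum_mono) (simp only: abs_mult K'_def mem_Collect_eq lessThan_iff mult_right_mono abs_ge_zero)
    also have "\<dots> \<le> R'"
      unfolding R'_def using j R0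
      by (intro member_le_sum[of j "{..<?n}" "\<lambda>j. \<Sum>i<?n. R * \<bar>?b j i\<bar>"])
        (auto intro!: sum_nonneg simp del: fun_upd_apply sum.lessThan_Suc)
    finally show ?thesis .
  qed
  have pos: "measure (leb ?n) K' > 0"
  proof -
    have "measure (leb ?n) K' = measure (distr (leb ?n) borel ?T) K"
      by (simp add: measure_distr K'_def vimage_def)
    then show ?thesis using convex_body_measure_pos[OF K] by (simp add: distr_leb_lincomb[OF b])
  qed
  have centered: "(LINT x:K'|leb ?n. x j) = 0" if j: "j < ?n" for j
  proof -
    have "(LINT x:K'|leb ?n. x j) = (LINT x|leb ?n. indicator K (?T x) *\<^sub>R dot ?n (?b j) (?T x))"
      unfolding set_lebesgue_integral_def dot_commute[of _ "?b j"] dot_lincomb_frame[OF b j]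
      by (intro Bochner_Integration.integral_cong) (auto simp: K'_def indicator_def)
    also have "\<dots> = (LINT y|distr (leb ?n) borel ?T. indicator K y *\<^sub>R dot ?n (?b j) y)"
      by (rule integral_distr[symmetric]) measurable
    also have "\<dots> = (LINT y:K|leb ?n. dot ?n (?b j) y)"
      by (simp only: distr_leb_lincomb[OF b] set_lebesgue_integral_def)
    also have "\<dots> = 0"
      using integral_linear_form_eq_0[OF c(3) R centroid_0_imp_centered[OF K cent]] by blast
    finally show ?thesis .
  qed
  have T0: "?T (x(m := 0)) = lincomb m e x" for x
    by (simp add: lincomb_Suc_upd)
  have H: "lincomb m e x \<in> hyperplane ?n u" for x using b by (rule lincomb_in_hyperplane)
  have L_sets: "K \<inter> hyperplane ?n u \<in> sets borel"
    using borel_closed[OF closed_hyperplane] by measurable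
  have half_sets: "{y \<in> K \<inter> hyperplane ?n u. 0 \<le> dot ?n z y} \<in> sets borel"
    using L_sets by measurable
  have s1: "{x. x(m := 0) \<in> K'} = {x. lincomb m e x \<in> K \<inter> hyperplane ?n u}"
    using H by (simp add: K'_def T0)
  have s2: "{x. x(m := 0) \<in> K' \<and> 0 \<le> (\<Sum>j<m. dot ?n z (e j) * x j)}
      = {x. lincomb m e x \<in> {y \<in> K \<inter> hyperplane ?n u. 0 \<le> dot ?n z y}}"
    using H by (simp add: K'_def T0 dot_commute[of _ z] dot_lincomb_left mult.commute)
  have "measure (leb m) {x. x(m := 0) \<in> K'} / 64
      \<le> measure (leb m) {x. x(m := 0) \<in> K' \<and> 0 \<le> (\<Sum>j<m. dot ?n z (e j) * x j)}"
    by (rule section_half_through_centroid[where R = R']) (use conv bd pos centered in auto)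
  then show ?thesis
    unfolding s1 s2 measure_def emeasure_hyperplane_leb[OF hl L_sets] emeasure_hyperplane_leb[OF hl half_sets] .
qed

lemma emeasure_hyperplane_leb_translate:
  assumes u: "u \<in> unit_sphere (Suc m)" and z: "z \<in> hyperplane (Suc m) u"
    and A[measurable]: "A \<in> sets borel" and B[measurable]: "B \<in> sets borel"
    and sub: "\<And>y. y \<in> A \<Longrightarrow> (\<lambda>i. y i + z i) \<in> B"
  shows "emeasure (hyperplane_leb (Suc m) u) A \<le> emeasure (hyperplane_leb (Suc m) u) B"
proof -
  obtain e where b: "orthonormal_frame (Suc m) (e(m := u))"
      and hl: "hyperplane_leb (Suc m) u = distr (leb m) borel (lincomb m e)"
    using hyperplane_leb_frame[OF u] .
  define c where "c j = (if j < m then dot (Suc m) z (e j) else 0)" for j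
  have c: "c \<in> Rn m" by (simp add: c_def topspace_Euclidean_space)
  have "lincomb m e c = z"
    using hyperplane_coordinates[OF b z] by (simp add: lincomb_def c_def)
  then have add: "lincomb m e (\<lambda>i. a i + c i) = (\<lambda>i. lincomb m e a i + z i)" for a
    by (auto simp: lincomb_def sum.distrib distrib_right)
  have emeasure_eq: "emeasure (leb m) {a. lincomb m e a \<in> X} = (\<integral>\<^sup>+a. indicator X (lincomb m e a) \<partial>leb m)"
    if [measurable]: "X \<in> sets borel" for X
  proof -
    have "(\<integral>\<^sup>+a. indicator X (lincomb m e a) \<partial>leb m) = (\<integral>\<^sup>+a. indicator {a. lincomb m e a \<in> X} a \<partial>leb m)"
      by (simp add: indicator_def)
    then show ?thesis by simp
  qed
  have "emeasure (leb m) {a. lincomb m e a \<in> A} = (\<integral>\<^sup>+a. indicator A (lincomb m e a) \<partial>leb m)"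
    by (rule emeasure_eq) fact
  also have "\<dots> \<le> (\<integral>\<^sup>+a. indicator B (lincomb m e (\<lambda>i. a i + c i)) \<partial>leb m)"
    using sub by (intro nn_integral_mono) (auto simp: indicator_def add)
  also have "\<dots> = (\<integral>\<^sup>+a. indicator B (lincomb m e a) \<partial>leb m)"
    by (rule nn_integral_leb_translate[of "\<lambda>a. indicator B (lincomb m e a)"]) (auto simp: c)
  also have "\<dots> = emeasure (leb m) {a. lincomb m e a \<in> B}"
    by (rule emeasure_eq[symmetric]) fact
  finally show ?thesis by (simp add: emeasure_hyperplane_leb[OF hl])
qed

lemma dot_proj:
  assumes "y \<in> hyperplane n u"
  shows "dot n y (proj n u x) = dot n y x"
proof -
  have "dot n y u = 0" using assms by (simp add: hyperplane_def dot_commute)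
  then show ?thesis by (simp add: proj_def dot_vdiff_right dot_smul_right)
qed

text \<open>
  For \<open>x\<close> in the projected polar body, \<open>\<langle>(y + z) - z, x - z\<rangle> = \<langle>y, x\<rangle> - \<langle>z, y\<rangle>\<close>, where the first term is at most \<open>1\<close>
  because \<open>y \<in> K\<close>. The half section is thus contained, up to translation, in every polar \<open>(P\<^sub>u K\<^sup>*)\<^bsup>*z\<^esup>\<close>.
\<close>

lemma translate_in_hyperplane_polar:
  assumes z: "z \<in> hyperplane n u" and y: "y \<in> K \<inter> hyperplane n u" "0 \<le> dot n z y"
  shows "(\<lambda>i. y i + z i) \<in> hyperplane_polar n u z (proj n u ` polar n K)"
  unfolding hyperplane_polar_def
proof (intro CollectI conjI ballI)
  show "(\<lambda>i. y i + z i) \<in> hyperplane n u"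
    using y(1) z by (auto simp: hyperplane_def topspace_Euclidean_space dot_def distrib_left sum.distrib)
  fix x' assume "x' \<in> proj n u ` polar n K"
  then obtain x where x: "x \<in> polar n K" "x' = proj n u x" by blast
  have "dot n (vdiff (\<lambda>i. y i + z i) z) (vdiff x' z) = dot n y (vdiff x' z)"
    by (simp add: vdiff_def)
  also have "\<dots> = dot n y x - dot n z y"
    using y(1) x(2) by (simp add: dot_vdiff_right dot_proj dot_commute[of n y z])
  also have "\<dots> \<le> 1"
    using x(1) y by (auto simp: polar_def intro: order_trans[of _ "dot n y x"])
  finally show "dot n (vdiff (\<lambda>i. y i + z i) z) (vdiff x' z) \<le> 1" .
qed

text \<open>
  Polarity turns the projection into a section: on \<open>u\<^sup>\<bottom>\<close> the vectors \<open>x\<close> and \<open>P\<^sub>u x\<close> define the same linear form, so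
  the polar of \<open>P\<^sub>u K\<^sup>*\<close> in \<open>u\<^sup>\<bottom>\<close> consists of the points of \<open>u\<^sup>\<bottom>\<close> in the bipolar of \<open>K\<close>.
\<close>

lemma hyperplane_polar_proj_polar_at_0:
  assumes "compact K" "convex_set K" "K \<subseteq> Rn n" "(\<lambda>_. 0) \<in> K"
  shows "hyperplane_polar n u (\<lambda>_. 0) (proj n u ` polar n K) \<subseteq> K \<inter> hyperplane n u"
proof
  fix y assume y: "y \<in> hyperplane_polar n u (\<lambda>_. 0) (proj n u ` polar n K)"
  then have yu: "y \<in> hyperplane n u" by (simp add: hyperplane_polar_def)
  have "dot n y x \<le> 1" if "x \<in> polar n K" for x
  proof -
    have "dot n (vdiff y (\<lambda>_. 0)) (vdiff (proj n u x) (\<lambda>_. 0)) \<le> 1"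
      using y that unfolding hyperplane_polar_def by blast
    then show ?thesis using dot_proj[OF yu, of x] by (simp add: vdiff_def)
  qed
  moreover have "y \<in> Rn n" using yu unfolding hyperplane_def by blast
  ultimately have "y \<in> K" by (intro bipolar[OF assms])
  then show "y \<in> K \<inter> hyperplane n u" using yu by simp
qed

text \<open>
  The two inclusions for a fixed direction \<open>u\<close>. The infimum is compared in \<^typ>\<open>ennreal\<close>; it is finite by the bound for \<open>z = 0\<close>,
  so the lower bound by half sections survives the passage to real numbers.
\<close>

lemma radial_functions_comparable:
  assumes K: "convex_body (Suc m) K" and cent: "centroid (Suc m) K = (\<lambda>_. 0)"
    and u: "u \<in> unit_sphere (Suc m)"
  defines "r \<equiv> measure (hyperplane_leb (Suc m) u) (K \<inter> hyperplane (Suc m) u)"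
    and "s \<equiv> enn2real (INF z\<in>hyperplane (Suc m) u. emeasure (hyperplane_leb (Suc m) u)
           (hyperplane_polar (Suc m) u z (proj (Suc m) u ` polar (Suc m) K)))"
  shows "r / 64 \<le> s" "s \<le> r"
proof -
  let ?n = "Suc m"
  let ?\<mu> = "hyperplane_leb ?n u"
  let ?P = "\<lambda>z. hyperplane_polar ?n u z (proj ?n u ` polar ?n K)"
  let ?L = "K \<inter> hyperplane ?n u"
  let ?I = "INF z\<in>hyperplane ?n u. emeasure ?\<mu> (?P z)"
  note c = convex_body_compact[OF K]
  note [measurable] = c(3)
  have sets: "sets ?\<mu> = sets borel" by (simp add: hyperplane_leb_def Let_def)
  have L[measurable]: "?L \<in> sets borel"
    using borel_closed[OF closed_hyperplane] by measurable
  have P: "?P z \<in> sets borel" for z by (intro borel_closed closed_hyperplane_polar)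
  have fin: "emeasure ?\<mu> ?L < \<infinity>"
  proof -
    obtain e where b: "orthonormal_frame ?n (e(m := u))"
        and hl: "?\<mu> = distr (leb m) borel (lincomb m e)"
      using hyperplane_leb_frame[OF u] .
    have "continuous_on K (\<lambda>x. \<lambda>j. dot ?n x (e j))"
      by (intro continuous_on_coordinatewise_then_product continuous_on_dot continuous_on_id continuous_on_const)
    then have "compact ((\<lambda>x. \<lambda>j. dot ?n x (e j)) ` K)"
      using c(1) by (rule compact_continuous_image)
    then obtain R where R: "\<forall>a\<in>(\<lambda>x. \<lambda>j. dot ?n x (e j)) ` K. \<forall>i<m. \<bar>a i\<bar> \<le> R"
      using compact_bounded_coordinates by blast
    have "\<bar>a i\<bar> \<le> R" if a: "a \<in> {a. lincomb m e a \<in> ?L}" and i: "i < m" for a i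
    proof -
      have "a i = dot ?n (lincomb m e a) (e i)"
        using dot_lincomb_frame[OF b, of i "a(m := 0)"] i by (simp add: lincomb_Suc_upd)
      then show ?thesis using R a i by auto
    qed
    then have "emeasure (leb m) {a. lincomb m e a \<in> ?L} < \<infinity>"
      by (intro emeasure_leb_bounded[of _ m R]) blast
    then show ?thesis by (simp add: emeasure_hyperplane_leb[OF hl L])
  qed
  have r: "emeasure ?\<mu> ?L = ennreal r"
    unfolding r_def using fin by (intro emeasure_eq_ennreal_measure) auto
  have zero: "(\<lambda>_. 0) \<in> hyperplane ?n u" by (simp add: hyperplane_def topspace_Euclidean_space dot_def)
  have "?I \<le> emeasure ?\<mu> (?P (\<lambda>_. 0))" using zero by (rule INF_lower)
  also have "\<dots> \<le> emeasure ?\<mu> ?L"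
    using hyperplane_polar_proj_polar_at_0[OF c(1,4,2) centroid_in_convex_body[OF K cent]] L
    by (intro emeasure_mono) (auto simp: sets)
  finally have up: "?I \<le> ennreal r" by (simp add: r)
  have low: "ennreal (r / 64) \<le> ?I"
  proof (rule INF_greatest)
    fix z assume z: "z \<in> hyperplane ?n u"
    let ?H = "{y \<in> ?L. 0 \<le> dot ?n z y}"
    have H[measurable]: "?H \<in> sets borel" by measurable
    have "emeasure ?\<mu> ?H \<le> emeasure ?\<mu> ?L" using L by (intro emeasure_mono) (auto simp: sets)
    then have "emeasure ?\<mu> ?H < \<infinity>" using fin by (rule le_less_trans)
    then have H_eq: "emeasure ?\<mu> ?H = ennreal (measure ?\<mu> ?H)"
      by (intro emeasure_eq_ennreal_measure less_imp_neq) simp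
    have "r / 64 \<le> measure ?\<mu> ?H"
      unfolding r_def by (rule half_section_of_centered_body[OF K cent u])
    then have "ennreal (r / 64) \<le> emeasure ?\<mu> ?H" unfolding H_eq by (rule ennreal_leI)
    also have "\<dots> \<le> emeasure ?\<mu> (?P z)"
      by (intro emeasure_hyperplane_leb_translate[OF u z H P] translate_in_hyperplane_polar[OF z]) auto
    finally show "ennreal (r / 64) \<le> emeasure ?\<mu> (?P z)" .
  qed
  have r0: "r \<ge> 0" by (simp add: r_def)
  have s: "s = enn2real ?I" unfolding s_def ..
  show "s \<le> r" unfolding s using up r0 by (rule enn2real_leI[rotated])
  have "?I < top" using up by (rule le_less_trans) simp
  then have "ennreal s = ?I" unfolding s by (rule ennreal_enn2real)
  then have "ennreal (r / 64) \<le> ennreal s" using low by (simp only:)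
  moreover have "s \<ge> 0" unfolding s by (rule enn2real_nonneg)
  ultimately show "r / 64 \<le> s" by simp
qed

theorem theorem2:
  shows "\<exists>c::real. c > 0 \<and>
    (\<forall>n\<ge>2. \<forall>K. convex_body n K \<and> centroid n K = (\<lambda>_. 0) \<longrightarrow>
       smul c ` intersection_body n K \<subseteq> convex_intersection_body n K \<and>
       convex_intersection_body n K \<subseteq> intersection_body n K)"
proof (intro exI[of _ "1 / 64"] conjI allI impI)
  fix n :: nat and K assume n: "2 \<le> n" and K: "convex_body n K \<and> centroid n K = (\<lambda>_. 0)"
  obtain m where m: "n = Suc m" using n by (cases n) auto
  note cmp = radial_functions_comparable[of m K, folded m, OF conjunct1[OF K] conjunct2[OF K]]
  show "convex_intersection_body n K \<subseteq> intersection_body n K"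
    unfolding convex_intersection_body_def intersection_body_def radial_body_def
    using cmp(2) by (blast intro: order_trans)
  show "smul (1 / 64) ` intersection_body n K \<subseteq> convex_intersection_body n K"
  proof
    fix x assume "x \<in> smul (1 / 64) ` intersection_body n K"
    then obtain t u where x: "x = smul (1 / 64) (smul t u)" and u: "u \<in> unit_sphere n"
        and t: "0 \<le> t" "t \<le> measure (hyperplane_leb n u) (K \<inter> hyperplane n u)"
      unfolding intersection_body_def radial_body_def by blast
    have "x = smul (t / 64) u" "0 \<le> t / 64" using x t by simp_all
    moreover have "t / 64 \<le> enn2real (INF z\<in>hyperplane n u.
          emeasure (hyperplane_leb n u) (hyperplane_polar n u z (proj n u ` polar n K)))"
      using cmp(1)[OF u] t(2) by simp
    ultimately show "x \<in> convex_intersection_body n K"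
      unfolding convex_intersection_body_def radial_body_def using u by blast
  qed
qed simp

end
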